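(* Let $\mathscr{L}=\{(S_\lambda,\mathscr{S}_\lambda,\nu_\lambda)\}_{\lambda\downarrow 0}$ be a unit lens on a complex manifold $\mathscr{M}$ of dimension $n$, and let $\psi\in\mathscr{P}$ be a meromorphic, $\nu_\lambda$-measurable function on $S_\lambda$ with values in $\mathbb{C}^k$ and with a potential pole of order $1$ at $p_0\in S_\lambda$. Let $\eta$ and $\mathscr{D}$ denote the residue matrix and the Jacobian matrix of $\psi$ on $\mathscr{L}$. Then: (a) the standard error $\sigma_\psi$ of $\psi$ at scale $\lambda$ under the exterior probability $\nu_\lambda$ has the lower bound $$\lambda\,\sigma_\psi\ \geq\ \sqrt{\mathrm{Tr}(\eta^*\eta)};$$ (b) as the scale $\lambda$ varies, the minimum standard error is achieved at the finite scale $$\lambda_*=\left[\frac{\mathrm{Tr}(\eta^*\eta)}{\mathrm{Tr}(\mathscr{D}^*\mathscr{D})}\right]^{1/4}.$$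
   Context: Exterior probability on the disc. For $\lambda>0$ and an interval $I\subset[-\pi,\pi]$, put $\Gamma_\lambda(I)=\{w\in\mathbb{C}: |w|\le\lambda,\ \arg(w)\in I\}$ (a slice) and $\gamma_\lambda(I)=\{w\in\mathbb{C}: |w|=\lambda,\ \arg(w)\in I\}$ (the corresponding arc, traversed counterclockwise). Let $E_\lambda$ be the collection of all slices $\Gamma_\lambda(I)$, $\mathscr{E}_\lambda=\sigma(E_\lambda)$ the generated $\sigma$-algebra on $\{|w|\le\lambda\}$, and $\mu_\lambda$ the measure on $\mathscr{E}_\lambda$ extending $\mu_\lambda(\Gamma_\lambda(I))=\frac{1}{2\pi i}\int_{\gamma_\lambda(I)}\frac{dw}{w}$. Let $(\mathscr{E}^n_\lambda,\mu^n_\lambda)$ be the $n$-fold product on the closed poly-disc $D_\lambda=\{w\in\mathbb{C}^n: |w_\alpha|\le\lambda\ \forall\alpha\}$ (also written $D_\lambda^n$). $\mu^n_\lambda$ is called the exterior probability. Contour integral convention. $\oint_{D_\lambda}F$ denotes the iterated contour integral of $F(w)\,dw_1\cdots dw_n$ over $\{|w_1|=\lambda\}\times\cdots\times\{|w_n|=\lambda\}$. Poly-disc and unit lens on $\mathscr{M}$. Let $\mathscr{M}$ be a complex manifold of dimension $n$ with holomorphic structure (atlas) $\mathscr{A}$, and $p_0\in\mathscr{M}$. For a chart $(z,U)\in\mathscr{A}$ let $S_\lambda=z^{-1}(D_\lambda)$ and $\mathscr{Z}(S_\lambda)=\{z'=g\circ z: g\text{ is a holomorphism on }z(U)\}$;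 elements of $\mathscr{Z}(S_\lambda)$ are called morphs, and $(S_\lambda,\mathscr{Z}(S_\lambda))$ is a poly-disc around $p_0$. A morph $z$ is used as a bijective holomorphic coordinate from $S_\lambda$ onto $D_\lambda$ with $z(p_0)=0$. Under a morph $z$, $\mathscr{S}_\lambda=z^{-1}(\mathscr{E}^n_\lambda)$ and $\nu_\lambda(A)=\mu^n_\lambda(z(A))$ for $A\in\mathscr{S}_\lambda$. A unit lens is the filtration of probability spaces $\{(S_\lambda,\mathscr{S}_\lambda,\nu_\lambda)\}_{\lambda\downarrow0}$ indexed by the scale $\lambda$. Functions. Fix a morph $z$. $\mathscr{P}$ is the vector space of all meromorphic functions $\psi:\mathscr{M}\to\mathbb{C}^k$ with a pole of order at most $1$ at $p_0$, i.e. $\psi_z=\psi\circ z^{-1}:\mathbb{C}^n\to\mathbb{C}^k$ is analytic everywhere except for a (potential) pole at $z(p_0)=0$. Expectation and inner product are $$E(\psi)=\int_{S_\lambda}\psi\,d\nu_\lambda=\frac{1}{(2\pi i)^n}\oint_{D_\lambda}\frac{\psi_z(w)}{\prod_\alpha w_\alpha},\qquad \langle\psi,\phi\rangle=\int_{S_\lambda}\psi^*\phi\,d\nu_\lambda=\frac{1}{(2\pi i)^n}\oint_{D_\lambda}\frac{\psi_z(w)^*\phi_z(w)}{\prod_\alpha w_\alpha},$$ where $^*$ is conjugate transpose. The variance at scale $\lambda$ is $\sigma_\psi^2=\langle\psi,\psi\rangle-\|E(\psi)\|^2$, and $\sigma_\psi$ is the standard error. Decomposition. $\psi_z=\psi_0+\psi_P+\psi_A$,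 where the core is $\psi_0^\alpha=\frac{1}{(2\pi i)^n}\oint_{D_\lambda}\frac{\psi_z^\alpha(w)}{\prod_{\mu}w_\mu}$; the principal component is $\psi_P^\alpha=\sum_{\beta=1}^n\frac{\eta^\alpha_\beta}{w_\beta}$ with residue matrix $\eta^\alpha_\beta=\frac{1}{(2\pi i)^n}\oint_{D_\lambda}\frac{\psi_z^\alpha(w)}{\prod_{\mu\neq\beta}w_\mu}$; and the analytic component $\psi_A=\psi_z-\psi_0-\psi_P$ is given near $0$ by a convergent power series $\psi_A^\alpha=\sum_\beta\mathscr{D}^{\alpha\beta}w_\beta+P^\alpha(w)$ with $P^\alpha$ a power series of lowest degree at least $2$. $\mathscr{D}^{\alpha\beta}=\partial\psi_A^\alpha/\partial w_\beta|_{w=0}$ is the Jacobian matrix. $\eta$ and $\mathscr{D}$ are taken with respect to the fixed morph $z$.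
   Formalization: Part (b) fails for ψ=1/w+w+w². It is proved for σ_ψ when the power series P vanishes near 0, and otherwise for ψ with P dropped (variance changes by O(λ⁴) as λ→0), assuming η≠0, D≠0 and that λ_* is a scale of the lens. *)

theory Defs
  imports "HOL-Complex_Analysis.Complex_Analysis" "HOL-Library.Landau_Symbols"
begin

no_notation fps_nth (infixl "$" 75)

section \<open>Exterior probability on the polydisc\<close>

definition slice :: "real \<Rightarrow> real set \<Rightarrow> complex set" where
  "slice r I = {w. cmod w \<le> r \<and> Arg w \<in> I}"

definition slice_intervals :: "real set set" where
  "slice_intervals = {I. I \<noteq> {} \<and> is_interval I \<and> I \<subseteq> {-pi..pi}}"

definition slice_arc :: "real \<Rightarrow> real set \<Rightarrow> real \<Rightarrow> complex" where
  "slice_arc r I = part_circlepath 0 r (Inf I) (Sup I)"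

text \<open>
  The measure on the \<open>\<sigma>\<close>-algebra generated by the slices that extends
  \<open>\<Gamma>(I) \<mapsto> 1/(2 \<pi> i) \<integral>\<^bsub>\<gamma>(I)\<^esub> dw/w\<close>.  Existence and uniqueness of the extension are
  established below (\<open>emeasure_exterior1_slice\<close>, \<open>exterior1_eq_distr\<close>).
\<close>
definition exterior1 :: "real \<Rightarrow> complex measure" where
  "exterior1 r = extend_measure (cball 0 r) slice_intervals (slice r)
     (\<lambda>I. ennreal (Re (contour_integral (slice_arc r I) (\<lambda>w. 1 / w) / (2 * pi * \<i>))))"

definition polydisc :: "real \<Rightarrow> (complex^'n) set" where
  "polydisc r = {w. \<forall>\<alpha>. cmod (w $ \<alpha>) \<le> r}"

text \<open>The \<open>n\<close>-fold product of \<open>exterior1\<close>, carried over from functions to vectors.\<close>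
definition exterior :: "real \<Rightarrow> (complex^'n) measure" where
  "exterior r =
     distr (Pi\<^sub>M UNIV (\<lambda>_. exterior1 r))
       (vimage_algebra (polydisc r) vec_nth (Pi\<^sub>M UNIV (\<lambda>_. exterior1 r)))
       vec_lambda"


section \<open>Complex manifolds, morphs and unit lenses\<close>

text \<open>Intended for open \<open>S\<close>: Frechet differentiable with complex-linear derivative.\<close>
definition holomorphic_map_on :: "(complex^'n \<Rightarrow> complex^'m) \<Rightarrow> (complex^'n) set \<Rightarrow> bool" where
  "holomorphic_map_on f S \<longleftrightarrow>
     (\<forall>w\<in>S. \<exists>f'. (f has_derivative f') (at w) \<and> (\<forall>c v. f' (c *s v) = c *s f' v))"

definition biholomorphic_map_on :: "(complex^'n \<Rightarrow> complex^'n) \<Rightarrow> (complex^'n) set \<Rightarrow> bool" where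
  "biholomorphic_map_on g S \<longleftrightarrow>
     holomorphic_map_on g S \<and> inj_on g S \<and> open (g ` S) \<and>
     holomorphic_map_on (inv_into S g) (g ` S)"

text \<open>
  A holomorphic atlas for the manifold carried by the type \<open>'m\<close>; a chart is a pair \<open>(U, z)\<close>
  and \<open>z\<close> is relevant on \<open>U\<close> only.
\<close>
definition holomorphic_atlas ::
    "('m::{t2_space,second_countable_topology} set \<times> ('m \<Rightarrow> complex^'n)) set \<Rightarrow> bool" where
  "holomorphic_atlas \<A> \<longleftrightarrow>
     (\<Union>(U, z)\<in>\<A>. U) = UNIV \<and>
     (\<forall>(U, z)\<in>\<A>. open U \<and> open (z ` U) \<and> homeomorphism U (z ` U) z (inv_into U z)) \<and>
     (\<forall>(U, z)\<in>\<A>. \<forall>(V, y)\<in>\<A>. holomorphic_map_on (y \<circ> inv_into U z) (z ` (U \<inter> V)))"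

definition morphs :: "'m set \<Rightarrow> ('m \<Rightarrow> complex^'n) \<Rightarrow> ('m \<Rightarrow> complex^'n) set" where
  "morphs U \<zeta> = {g \<circ> \<zeta> | g. biholomorphic_map_on g (\<zeta> ` U)}"

definition centred_morph ::
    "('m set \<times> ('m \<Rightarrow> complex^'n)) set \<Rightarrow> 'm \<Rightarrow> 'm set \<Rightarrow> ('m \<Rightarrow> complex^'n) \<Rightarrow> bool" where
  "centred_morph \<A> p0 U z \<longleftrightarrow>
     (\<exists>\<zeta>. (U, \<zeta>) \<in> \<A> \<and> z \<in> morphs U \<zeta>) \<and> p0 \<in> U \<and> z p0 = 0"

text \<open>
  The scales at which \<open>z\<close> maps the disc \<open>S\<^sub>r = z\<^sup>-\<^sup>1(D\<^sub>r)\<close> onto the whole polydisc \<open>D\<^sub>r\<close>; these are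
  all \<open>r > 0\<close> if \<open>z\<close> is onto the whole coordinate space.
\<close>
definition scales :: "'m set \<Rightarrow> ('m \<Rightarrow> complex^'n) \<Rightarrow> real set" where
  "scales U z = {r. 0 < r \<and> polydisc r \<subseteq> z ` U}"

definition lens_disc :: "'m set \<Rightarrow> ('m \<Rightarrow> complex^'n) \<Rightarrow> real \<Rightarrow> 'm set" where
  "lens_disc U z r = {p \<in> U. z p \<in> polydisc r}"

text \<open>
  The unit lens as a family of measures: space \<open>S\<^sub>r\<close>, \<open>\<sigma>\<close>-algebra \<open>z\<^sup>-\<^sup>1(\<E>\<^sup>n\<^sub>r)\<close> and
  \<open>\<nu>\<^sub>r(A) = \<mu>\<^sup>n\<^sub>r(z(A))\<close>.
\<close>
definition unit_lens :: "'m set \<Rightarrow> ('m \<Rightarrow> complex^'n) \<Rightarrow> real \<Rightarrow> 'm measure" where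
  "unit_lens U z r =
     measure_of (lens_disc U z r)
       {z -` B \<inter> lens_disc U z r | B. B \<in> sets (exterior r)}
       (\<lambda>A. emeasure (exterior r) (z ` A))"

definition boundary_point :: "real \<Rightarrow> complex^'n \<Rightarrow> complex^'n" where
  "boundary_point r w = (\<chi> \<alpha>. rcis r (Arg (w $ \<alpha>)))"

text \<open>
  Slices are unions of rays, and their measure is computed on the boundary arc.  A function on
  \<open>S\<^sub>r\<close> is therefore measured and integrated against \<open>\<nu>\<^sub>r\<close> through its boundary values, extended
  constantly along rays.  (Measurability of the function itself would force it to be
  constant along rays, which no nonconstant meromorphic function is.)
\<close>
definition boundary_trace ::
    "'m set \<Rightarrow> ('m \<Rightarrow> complex^'n) \<Rightarrow> ('m \<Rightarrow> 'b) \<Rightarrow> real \<Rightarrow> 'm \<Rightarrow> 'b" where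
  "boundary_trace U z \<psi> r p = \<psi> (inv_into U z (boundary_point r (z p)))"

definition lens_measurable ::
    "'m set \<Rightarrow> ('m \<Rightarrow> complex^'n) \<Rightarrow> ('m \<Rightarrow> 'b::topological_space) \<Rightarrow> real \<Rightarrow> bool" where
  "lens_measurable U z \<psi> r \<longleftrightarrow> boundary_trace U z \<psi> r \<in> borel_measurable (unit_lens U z r)"


section \<open>Expectation, inner product and standard error\<close>

fun iterated_contour ::
    "real \<Rightarrow> 'n list \<Rightarrow> (complex^'n \<Rightarrow> complex) \<Rightarrow> complex^'n \<Rightarrow> complex" where
  "iterated_contour r [] F w = F w"
| "iterated_contour r (\<alpha> # \<alpha>s) F w =
     contour_integral (circlepath 0 r)
       (\<lambda>t. iterated_contour r \<alpha>s F (\<chi> \<beta>. if \<beta> = \<alpha> then t else w $ \<beta>))"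

text \<open>
  The order of integration is irrelevant for integrands continuous on the torus; the base point
  \<open>0\<close> is overwritten in every coordinate.
\<close>
definition polydisc_contour :: "real \<Rightarrow> (complex^'n \<Rightarrow> complex) \<Rightarrow> complex" where
  "polydisc_contour r F =
     iterated_contour r (SOME \<alpha>s. distinct \<alpha>s \<and> set \<alpha>s = UNIV) F 0"

definition coord_rep :: "'m set \<Rightarrow> ('m \<Rightarrow> complex^'n) \<Rightarrow> ('m \<Rightarrow> 'b) \<Rightarrow> complex^'n \<Rightarrow> 'b" where
  "coord_rep U z \<psi> = \<psi> \<circ> inv_into U z"

definition expectation ::
    "'m set \<Rightarrow> ('m \<Rightarrow> complex^'n) \<Rightarrow> ('m \<Rightarrow> complex^'k) \<Rightarrow> real \<Rightarrow> complex^'k" where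
  "expectation U z \<psi> r =
     (\<chi> a. polydisc_contour r (\<lambda>w. coord_rep U z \<psi> w $ a / (\<Prod>\<alpha>\<in>UNIV. w $ \<alpha>))
           / (2 * pi * \<i>) ^ CARD('n))"

definition lens_inner ::
    "'m set \<Rightarrow> ('m \<Rightarrow> complex^'n) \<Rightarrow> ('m \<Rightarrow> complex^'k) \<Rightarrow> ('m \<Rightarrow> complex^'k) \<Rightarrow> real \<Rightarrow> complex" where
  "lens_inner U z \<psi> \<phi> r =
     polydisc_contour r
       (\<lambda>w. (\<Sum>a\<in>UNIV. cnj (coord_rep U z \<psi> w $ a) * coord_rep U z \<phi> w $ a) / (\<Prod>\<alpha>\<in>UNIV. w $ \<alpha>))
     / (2 * pi * \<i>) ^ CARD('n)"

definition lens_variance ::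
    "'m set \<Rightarrow> ('m \<Rightarrow> complex^'n) \<Rightarrow> ('m \<Rightarrow> complex^'k) \<Rightarrow> real \<Rightarrow> real" where
  "lens_variance U z \<psi> r = Re (lens_inner U z \<psi> \<psi> r) - (norm (expectation U z \<psi> r))\<^sup>2"

definition std_error ::
    "'m set \<Rightarrow> ('m \<Rightarrow> complex^'n) \<Rightarrow> ('m \<Rightarrow> complex^'k) \<Rightarrow> real \<Rightarrow> real" where
  "std_error U z \<psi> r = sqrt (lens_variance U z \<psi> r)"


section \<open>Poles of order at most one and the decomposition\<close>

definition principal :: "complex^'n^'k \<Rightarrow> complex^'n \<Rightarrow> complex^'k" where
  "principal \<eta> w = (\<chi> a. \<Sum>\<beta>\<in>UNIV. \<eta> $ a $ \<beta> / w $ \<beta>)"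

definition off_axes :: "(complex^'n) set" where
  "off_axes = {w. \<forall>\<beta>. w $ \<beta> \<noteq> 0}"

text \<open>
  Functions that are holomorphic in the chart apart from a pole of order at most one at the
  centre, of the form \<open>\<Sum>\<^sub>\<beta> \<eta>\<^sub>\<beta>/w\<^sub>\<beta>\<close>.  For \<open>n = 1\<close> this is the usual notion of an at most simple
  pole.  For \<open>n > 1\<close> the polar locus is contained in the coordinate hyperplanes (there are no
  isolated poles); the values that \<open>\<psi>\<close> takes there are irrelevant.
\<close>
definition pole_order_le_1 :: "'m set \<Rightarrow> ('m \<Rightarrow> complex^'n) \<Rightarrow> ('m \<Rightarrow> complex^'k) set" where
  "pole_order_le_1 U z =
     {\<psi>. \<exists>\<eta> h. holomorphic_map_on h (z ` U) \<and>
           (\<forall>w\<in>z ` U \<inter> off_axes. coord_rep U z \<psi> w = principal \<eta> w + h w)}"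

definition core ::
    "'m set \<Rightarrow> ('m \<Rightarrow> complex^'n) \<Rightarrow> ('m \<Rightarrow> complex^'k) \<Rightarrow> real \<Rightarrow> complex^'k" where
  "core U z \<psi> r =
     (\<chi> a. polydisc_contour r (\<lambda>w. coord_rep U z \<psi> w $ a / (\<Prod>\<mu>\<in>UNIV. w $ \<mu>))
           / (2 * pi * \<i>) ^ CARD('n))"

definition residue_matrix ::
    "'m set \<Rightarrow> ('m \<Rightarrow> complex^'n) \<Rightarrow> ('m \<Rightarrow> complex^'k) \<Rightarrow> real \<Rightarrow> complex^'n^'k" where
  "residue_matrix U z \<psi> r =
     (\<chi> a \<beta>. polydisc_contour r (\<lambda>w. coord_rep U z \<psi> w $ a / (\<Prod>\<mu>\<in>UNIV - {\<beta>}. w $ \<mu>))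
             / (2 * pi * \<i>) ^ CARD('n))"

text \<open>The limit fills in the removable singularities on the coordinate hyperplanes.\<close>
definition analytic_part ::
    "'m set \<Rightarrow> ('m \<Rightarrow> complex^'n) \<Rightarrow> ('m \<Rightarrow> complex^'k) \<Rightarrow> real \<Rightarrow> complex^'n \<Rightarrow> complex^'k" where
  "analytic_part U z \<psi> r w =
     Lim (at w within off_axes)
       (\<lambda>v. coord_rep U z \<psi> v - core U z \<psi> r - principal (residue_matrix U z \<psi> r) v)"

definition jacobian_matrix ::
    "'m set \<Rightarrow> ('m \<Rightarrow> complex^'n) \<Rightarrow> ('m \<Rightarrow> complex^'k) \<Rightarrow> real \<Rightarrow> complex^'n^'k" where
  "jacobian_matrix U z \<psi> r =
     (\<chi> a \<beta>. deriv (\<lambda>t. analytic_part U z \<psi> r (axis \<beta> t) $ a) 0)"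

definition higher_part ::
    "'m set \<Rightarrow> ('m \<Rightarrow> complex^'n) \<Rightarrow> ('m \<Rightarrow> complex^'k) \<Rightarrow> real \<Rightarrow> complex^'n \<Rightarrow> complex^'k" where
  "higher_part U z \<psi> r w = analytic_part U z \<psi> r w - jacobian_matrix U z \<psi> r *v w"

text \<open>
  \<open>\<psi>\<close> with the terms of degree at least two of its analytic component removed.  Such terms add
  contributions of order \<open>r\<^sup>4\<close> to the variance and displace its minimum: for \<open>1/w + w + w\<^sup>2\<close>
  the variance is \<open>r\<^sup>-\<^sup>2 + r\<^sup>2 + r\<^sup>4\<close>, which is not minimal at \<open>r = 1\<close>.
\<close>
definition first_order_part ::
    "'m set \<Rightarrow> ('m \<Rightarrow> complex^'n) \<Rightarrow> ('m \<Rightarrow> complex^'k) \<Rightarrow> real \<Rightarrow> 'm \<Rightarrow> complex^'k" where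
  "first_order_part U z \<psi> r p =
     core U z \<psi> r + principal (residue_matrix U z \<psi> r) (z p) + jacobian_matrix U z \<psi> r *v z p"

definition adjoint_matrix :: "complex^'n^'k \<Rightarrow> complex^'k^'n" where
  "adjoint_matrix A = (\<chi> i j. cnj (A $ j $ i))"

definition trace_sq :: "complex^'n^'k \<Rightarrow> real" where
  "trace_sq A = Re (trace (adjoint_matrix A ** A))"


section \<open>The contour formula is integration against the unit lens\<close>

lemma slice_intervals_bounds:
  assumes "I \<in> slice_intervals"
  shows "{Inf I<..<Sup I} \<subseteq> I" "I \<subseteq> {Inf I..Sup I}" "Inf I \<le> Sup I" "-pi \<le> Inf I" "Sup I \<le> pi"
    "I \<in> sets borel"
proof -
  have I: "I \<noteq> {}" "is_interval I" "I \<subseteq> {-pi..pi}"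
    using assms by (auto simp: slice_intervals_def)
  have bdd: "bdd_below I" "bdd_above I"
    using I(3) by (meson bdd_below_Icc bdd_below_mono, meson bdd_above_Icc bdd_above_mono)
  show "{Inf I<..<Sup I} \<subseteq> I"
  proof
    fix x assume x: "x \<in> {Inf I<..<Sup I}"
    obtain a where "a \<in> I" "a < x" using x I(1) bdd by (auto simp: cInf_less_iff)
    moreover obtain b where "b \<in> I" "x < b" using x I(1) bdd by (auto simp: less_cSup_iff)
    ultimately show "x \<in> I" using I(2) by (meson is_interval_1 less_imp_le)
  qed
  show "I \<subseteq> {Inf I..Sup I}" using bdd by (auto intro: cInf_lower cSup_upper)
  show "Inf I \<le> Sup I" using I(1) bdd by (intro cInf_le_cSup)
  show "-pi \<le> Inf I" using I by (intro cInf_greatest) auto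
  show "Sup I \<le> pi" using I by (intro cSup_least) auto
  show "I \<in> sets borel" using I(2) by (rule real_interval_borel_measurable)
qed

lemma slice_arc_integral:
  assumes "r > 0" "I \<in> slice_intervals"
  shows "contour_integral (slice_arc r I) (\<lambda>w. 1 / w) / (2 * pi * \<i>) = of_real ((Sup I - Inf I) / (2 * pi))"
proof (cases "Inf I = Sup I")
  case True
  then show ?thesis
    by (simp add: slice_arc_def contour_integral_integral vector_derivative_part_circlepath)
next
  case False
  then have lt: "Inf I < Sup I" using slice_intervals_bounds(3)[OF assms(2)] by simp
  have "contour_integral (slice_arc r I) (\<lambda>w. 1 / w) = integral {Inf I..Sup I} (\<lambda>t. \<i>)"
    unfolding slice_arc_def contour_integral_part_circlepath_eq[OF lt]
    using assms(1) by (intro integral_cong) auto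
  then show ?thesis using lt by (simp add: scaleR_conv_of_real of_real_diff)
qed

lemma slice_weight:
  assumes "r > 0" "I \<in> slice_intervals"
  shows "ennreal (Re (contour_integral (slice_arc r I) (\<lambda>w. 1 / w) / (2 * pi * \<i>)))
           = ennreal ((Sup I - Inf I) / (2 * pi))"
  unfolding slice_arc_integral[OF assms] Re_complex_of_real ..

definition angle_measure :: "real measure" where
  "angle_measure = density (restrict_space lborel {-pi<..pi}) (\<lambda>_. ennreal (1 / (2 * pi)))"

lemma space_angle_measure [simp]: "space angle_measure = {-pi<..pi}"
  and sets_angle_measure: "sets angle_measure = sets (restrict_space borel {-pi<..pi})"
  by (auto simp: angle_measure_def space_restrict_space sets_restrict_space)

lemma emeasure_angle_interval:
  assumes "I \<in> slice_intervals"
  shows "emeasure angle_measure (I \<inter> {-pi<..pi}) = ennreal ((Sup I - Inf I) / (2 * pi))"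
proof -
  note b = slice_intervals_bounds[OF assms]
  have "emeasure lborel (I \<inter> {-pi<..pi}) = ennreal (Sup I - Inf I)"
  proof (rule antisym)
    have "emeasure lborel (I \<inter> {-pi<..pi}) \<le> emeasure lborel {Inf I..Sup I}"
      using b(2) by (intro emeasure_mono) auto
    then show "emeasure lborel (I \<inter> {-pi<..pi}) \<le> ennreal (Sup I - Inf I)" using b by simp
    have "emeasure lborel {Inf I<..<Sup I} \<le> emeasure lborel (I \<inter> {-pi<..pi})"
      using b by (intro emeasure_mono) auto
    then show "ennreal (Sup I - Inf I) \<le> emeasure lborel (I \<inter> {-pi<..pi})" using b by simp
  qed
  moreover have "I \<inter> {-pi<..pi} \<in> sets (restrict_space lborel {-pi<..pi})"
    using b(6) by (auto simp: sets_restrict_space)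
  ultimately show ?thesis using b(3)
    by (simp add: angle_measure_def emeasure_density_const emeasure_restrict_space
        ennreal_mult[symmetric])
qed

lemma slices_subset: "slice r ` slice_intervals \<subseteq> Pow (cball 0 r)"
  by (auto simp: slice_def)

lemma space_exterior1 [simp]: "space (exterior1 r) = cball 0 r"
  and sets_exterior1: "sets (exterior1 r) = sigma_sets (cball 0 r) (slice r ` slice_intervals)"
  using slices_subset by (simp_all add: exterior1_def space_extend_measure sets_extend_measure)

lemma rcis_angle_vimage:
  assumes "r > 0"
  shows "rcis r -` slice r I \<inter> {-pi<..pi} = I \<inter> {-pi<..pi}"
proof -
  have "Arg (rcis r t) = t" if "-pi < t" "t \<le> pi" for t
    using assms that by (simp add: rcis_def Arg_times_of_real2 Arg_cis)
  then show ?thesis using assms by (auto simp: slice_def)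
qed

lemma rcis_measurable_exterior1 [measurable]:
  assumes "r > 0"
  shows "rcis r \<in> measurable angle_measure (exterior1 r)"
proof (rule measurable_sigma_sets[OF sets_exterior1 slices_subset])
  show "rcis r \<in> space angle_measure \<rightarrow> cball 0 r" using assms by auto
  fix A assume "A \<in> slice r ` slice_intervals"
  then obtain I where I: "I \<in> slice_intervals" "A = slice r I" by auto
  then show "rcis r -` A \<inter> space angle_measure \<in> sets angle_measure"
    using rcis_angle_vimage[OF assms, of I] slice_intervals_bounds(6)[OF I(1)]
    by (auto simp: sets_angle_measure sets_restrict_space)
qed

lemma emeasure_exterior1_slice:
  assumes "r > 0" "I \<in> slice_intervals"
  shows "emeasure (exterior1 r) (slice r I) =
           ennreal (Re (contour_integral (slice_arc r I) (\<lambda>w. 1 / w) / (2 * pi * \<i>)))"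
proof (rule emeasure_extend_measure[OF exterior1_def _ slices_subset])
  let ?N = "distr angle_measure (exterior1 r) (rcis r)"
  show "positive (sets (exterior1 r)) (emeasure ?N)" "countably_additive (sets (exterior1 r)) (emeasure ?N)"
    using emeasure_positive[of ?N] emeasure_countably_additive[of ?N] by simp_all
  fix J assume J: "J \<in> slice_intervals"
  then have "slice r J \<in> sets (exterior1 r)" by (auto simp: sets_exterior1)
  then show "emeasure ?N (slice r J) =
     ennreal (Re (contour_integral (slice_arc r J) (\<lambda>w. 1 / w) / (2 * pi * \<i>)))"
    using J assms(1) rcis_angle_vimage[OF assms(1), of J] emeasure_angle_interval[OF J]
    unfolding slice_weight[OF assms(1) J] by (simp add: emeasure_distr)
qed fact

lemma exterior1_eq_distr:
  assumes "r > 0"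
  shows "exterior1 r = distr angle_measure (exterior1 r) (rcis r)"
proof (rule measure_eqI_generator_eq[where \<Omega> = "cball 0 r" and E = "insert {} (slice r ` slice_intervals)"
      and A = "\<lambda>_. cball 0 r"])
  have full: "cball 0 r = slice r {-pi..pi}" "{-pi..pi} \<in> slice_intervals"
    using mpi_less_Arg Arg_le_pi by (auto simp: slice_def slice_intervals_def less_imp_le is_interval_cc)
  show "Int_stable (insert {} (slice r ` slice_intervals))"
  proof (rule Int_stableI)
    fix A B assume *: "A \<in> insert {} (slice r ` slice_intervals)" "B \<in> insert {} (slice r ` slice_intervals)"
    show "A \<inter> B \<in> insert {} (slice r ` slice_intervals)"
    proof (cases "A = {} \<or> B = {}")
      case False
      then obtain I J where IJ: "I \<in> slice_intervals" "A = slice r I" "J \<in> slice_intervals" "B = slice r J"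
        using * by auto
      then have AB: "A \<inter> B = slice r (I \<inter> J)" by (auto simp: slice_def)
      show ?thesis
      proof (cases "I \<inter> J = {}")
        case True then show ?thesis using AB by (simp add: slice_def)
      next
        case False
        then have "I \<inter> J \<in> slice_intervals"
          using IJ by (auto simp: slice_intervals_def intro: is_interval_Int)
        then show ?thesis using AB by auto
      qed
    qed auto
  qed
  show "insert {} (slice r ` slice_intervals) \<subseteq> Pow (cball 0 r)" using slices_subset by auto
  have "sigma_sets (cball 0 r) (slice r ` slice_intervals)
      = sigma_sets (cball 0 r) (insert {} (slice r ` slice_intervals))"
    by (intro sigma_sets_eqI) (auto intro: sigma_sets.Empty)
  then show "sets (exterior1 r) = sigma_sets (cball 0 r) (insert {} (slice r ` slice_intervals))"
    "sets (distr angle_measure (exterior1 r) (rcis r))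
       = sigma_sets (cball 0 r) (insert {} (slice r ` slice_intervals))"
    by (simp_all add: sets_exterior1)
  show "range (\<lambda>_. cball 0 r) \<subseteq> insert {} (slice r ` slice_intervals)" using full by auto
  show "emeasure (exterior1 r) X = emeasure (distr angle_measure (exterior1 r) (rcis r)) X"
    if X: "X \<in> insert {} (slice r ` slice_intervals)" for X
  proof (cases "X = {}")
    case False
    then obtain J where J: "J \<in> slice_intervals" "X = slice r J" using X by auto
    then have "slice r J \<in> sets (exterior1 r)" by (auto simp: sets_exterior1)
    then show ?thesis
      using J assms rcis_angle_vimage[OF assms, of J] emeasure_angle_interval[OF J(1)]
      unfolding J(2) emeasure_exterior1_slice[OF assms J(1)] slice_weight[OF assms J(1)]
      by (simp add: emeasure_distr)
  qed simp
  show "emeasure (exterior1 r) (cball 0 r) \<noteq> \<infinity>"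
    using emeasure_exterior1_slice[OF assms full(2)] full(1) by simp
qed simp

lemma prob_space_exterior1:
  assumes "r > 0"
  shows "emeasure (exterior1 r) (space (exterior1 r)) = 1"
proof -
  have full: "cball 0 r = slice r {-pi..pi}" "{-pi..pi} \<in> slice_intervals"
    using mpi_less_Arg Arg_le_pi by (auto simp: slice_def slice_intervals_def less_imp_le is_interval_cc)
  then show ?thesis
    using emeasure_exterior1_slice[OF assms full(2)] slice_arc_integral[OF assms full(2)] by simp
qed

lemma Arg_measurable_exterior1: "Arg \<in> borel_measurable (exterior1 r)"
proof (rule borel_measurable_iff_le[THEN iffD2], intro allI)
  fix a :: real
  show "{w \<in> space (exterior1 r). Arg w \<le> a} \<in> sets (exterior1 r)"
  proof (cases "a < -pi")
    case True
    then have "{w \<in> space (exterior1 r). Arg w \<le> a} = {}"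
      using mpi_less_Arg by (auto simp: not_le intro: less_trans)
    then show ?thesis by (simp only: sets.empty_sets)
  next
    case False
    have "{w \<in> space (exterior1 r). Arg w \<le> a} = slice r {-pi..min a pi}"
      using mpi_less_Arg Arg_le_pi by (auto simp: slice_def less_imp_le)
    moreover have "{-pi..min a pi} \<in> slice_intervals"
      using False by (auto simp: slice_intervals_def is_interval_cc)
    ultimately show ?thesis by (auto simp: sets_exterior1)
  qed
qed

lemma bounded_measurable_integrable_on:
  fixes g :: "real \<Rightarrow> complex"
  assumes [measurable]: "g \<in> borel_measurable borel" and bdd: "\<And>t. norm (g t) \<le> B"
  shows "g integrable_on {-pi..pi}"
proof (rule set_borel_integral_eq_integral)
  have "B \<ge> 0" using order_trans[OF norm_ge_zero bdd] .
  then show "set_integrable lborel {-pi..pi} g" unfolding set_integrable_def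
      by - (rule Bochner_Integration.integrable_bound[of _ "\<lambda>t. indicator {-pi..pi} t *\<^sub>R B"],
            rule integrable_scaleR_left, auto simp: bdd split: split_indicator)
qed

lemma exterior1_integral:
  fixes g :: "real \<Rightarrow> complex"
  assumes "r > 0" and [measurable]: "g \<in> borel_measurable borel" and bdd: "\<And>t. norm (g t) \<le> B"
  shows "(\<integral>x. g (Arg x) \<partial>exterior1 r) = integral {-pi..pi} g / (2 * pi)"
proof -
  have [measurable]: "Arg \<in> borel_measurable (exterior1 r)" by (rule Arg_measurable_exterior1)
  have "(\<integral>x. g (Arg x) \<partial>exterior1 r) = (\<integral>x. g (Arg x) \<partial>distr angle_measure (exterior1 r) (rcis r))"
    using exterior1_eq_distr[OF assms(1)] by simp
  also have "\<dots> = (\<integral>t. g (Arg (rcis r t)) \<partial>angle_measure)"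
    by (rule integral_distr) (use assms(1) in measurable)
  also have "\<dots> = (\<integral>t. g t \<partial>angle_measure)"
    using assms(1) by (intro Bochner_Integration.integral_cong refl)
      (auto simp: rcis_def Arg_times_of_real2 Arg_cis)
  also have "\<dots> = (\<integral>t. (1 / (2 * pi)) *\<^sub>R g t \<partial>restrict_space lborel {-pi<..pi})"
    unfolding angle_measure_def by (rule integral_density) (auto simp: measurable_restrict_space1)
  also have "\<dots> = (1 / (2 * pi)) *\<^sub>R (\<integral>t. g t \<partial>restrict_space lborel {-pi<..pi})"
    by simp
  also have "(\<integral>t. g t \<partial>restrict_space lborel {-pi<..pi}) = (LINT t:{-pi<..pi}|lborel. g t)"
    by (simp add: integral_restrict_space set_lebesgue_integral_def)
  also have "\<dots> = integral {-pi<..pi} g"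
  proof (rule set_borel_integral_eq_integral)
    have "B \<ge> 0" using order_trans[OF norm_ge_zero bdd] .
    then show "set_integrable lborel {-pi<..pi} g" unfolding set_integrable_def
      by - (rule Bochner_Integration.integrable_bound[of _ "\<lambda>t. indicator {-pi<..pi} t *\<^sub>R B"],
            rule integrable_scaleR_left, auto simp: bdd split: split_indicator)
  qed
  also have "\<dots> = integral {-pi..pi} g"
    by (rule integral_spike_set[OF empty_imp_negligible negligible_subset[of "{-pi}"]]) auto
  finally show ?thesis by (simp add: scaleR_conv_of_real field_simps)
qed


lemma circle_contour_integral:
  assumes "((\<lambda>t. f (rcis r t) * (\<i> * rcis r t)) has_integral I) {-pi..pi}"
  shows "contour_integral (circlepath 0 r) f = I"
proof -
  have "((\<lambda>t. f (0 + r * cis t) * r * \<i> * cis t) has_integral I) {-pi..pi}"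
    using assms by (simp add: rcis_def mult_ac)
  then have "(f has_contour_integral I) (part_circlepath 0 r (-pi) pi)"
    by (subst has_contour_integral_part_circlepath_iff) auto
  then have "(f has_contour_integral I) (shiftpath (1 / 2) (part_circlepath 0 r (-pi) pi))"
    by (rule has_contour_integral_shiftpath) auto
  moreover have "shiftpath (1 / 2) (part_circlepath 0 r (-pi) pi) = circlepath 0 r"
  proof
    fix x :: real
    have *: "part_circlepath 0 r (-pi) pi (1 / 2 + x) = circlepath 0 r x" for x
      by (simp add: part_circlepath_def circlepath linepath_def algebra_simps)
    have "part_circlepath 0 r (-pi) pi (1 / 2 + x - 1) = circlepath 0 r (x - 1)"
      using *[of "x - 1"] by (simp add: algebra_simps)
    also have "\<dots> = circlepath 0 r x" using circlepath_add1[of 0 r "x - 1"] by simp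
    finally show "shiftpath (1 / 2) (part_circlepath 0 r (-pi) pi) x = circlepath 0 r x"
      using *[of x] by (simp add: shiftpath_def)
  qed
  ultimately show ?thesis by (simp add: contour_integral_unique)
qed

lemma borel_measurable_vec_lambda:
  fixes f :: "'n::finite \<Rightarrow> 'a \<Rightarrow> real"
  assumes [measurable]: "\<And>i. f i \<in> borel_measurable M"
  shows "(\<lambda>x. \<chi> i. f i x) \<in> borel_measurable M"
proof -
  have "(\<lambda>x. \<chi> i. f i x) = (\<lambda>x. \<Sum>i\<in>UNIV. f i x *\<^sub>R (axis i 1 :: real^'n))"
    by (auto simp: fun_eq_iff vec_eq_iff axis_def if_distrib sum.delta' cong: if_cong)
  then show ?thesis by simp
qed

lemma product_sigma_finite_exterior1:
  assumes "r > 0" shows "product_sigma_finite (\<lambda>_::'i. exterior1 r)"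
proof -
  interpret finite_measure "exterior1 r"
    by (rule finite_measureI) (simp add: prob_space_exterior1[OF assms] del: space_exterior1)
  show ?thesis by unfold_locales
qed

lemma finite_measure_PiM_exterior1:
  assumes "r > 0" "finite I" shows "finite_measure (Pi\<^sub>M I (\<lambda>_. exterior1 r))"
proof -
  interpret product_sigma_finite "\<lambda>_. exterior1 r" by (rule product_sigma_finite_exterior1) fact
  have "emeasure (Pi\<^sub>M I (\<lambda>_. exterior1 r)) (space (Pi\<^sub>M I (\<lambda>_. exterior1 r)))
      = (\<Prod>i\<in>I. emeasure (exterior1 r) (space (exterior1 r)))"
    unfolding space_PiM using assms(2) by (rule emeasure_PiM) (rule sets.top)
  then show ?thesis
    by (intro finite_measureI) (simp add: prob_space_exterior1[OF assms(1)] del: space_exterior1)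
qed

lemma iterated_contour_cong:
  assumes "\<And>\<beta>. \<beta> \<notin> set \<alpha>s \<Longrightarrow> w $ \<beta> = w' $ \<beta>"
  shows "iterated_contour r \<alpha>s F w = iterated_contour r \<alpha>s F w'"
  using assms
proof (induction \<alpha>s arbitrary: w w')
  case Nil
  then have "w = w'" by (simp add: vec_eq_iff)
  then show ?case by simp
next
  case (Cons \<alpha> \<alpha>s)
  have "iterated_contour r \<alpha>s F (\<chi> \<beta>. if \<beta> = \<alpha> then t else w $ \<beta>)
      = iterated_contour r \<alpha>s F (\<chi> \<beta>. if \<beta> = \<alpha> then t else w' $ \<beta>)" for t
    by (rule Cons.IH) (use Cons.prems in auto)
  then show ?case by simp
qed

lemma iterated_contour_eq_integral:
  fixes K :: "real^'n \<Rightarrow> complex"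
  assumes r: "r > 0" and K: "continuous_on UNIV K" "\<And>\<theta>. norm (K \<theta>) \<le> B"
    and F: "\<And>\<theta>. F (\<chi> i. rcis r (\<theta> $ i)) = K \<theta>" and "distinct \<alpha>s"
  shows "iterated_contour r \<alpha>s (\<lambda>w. F w / (\<Prod>\<alpha>\<in>UNIV. w $ \<alpha>)) (\<chi> i. rcis r (\<theta> $ i)) =
     (2 * pi * \<i>) ^ length \<alpha>s / (\<Prod>i\<in>- set \<alpha>s. rcis r (\<theta> $ i)) *
       (\<integral>x. K (\<chi> i. if i \<in> set \<alpha>s then Arg (x i) else \<theta> $ i) \<partial>Pi\<^sub>M (set \<alpha>s) (\<lambda>_. exterior1 r))"
  using \<open>distinct \<alpha>s\<close>
proof (induction \<alpha>s arbitrary: \<theta>)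
  case Nil
  interpret product_sigma_finite "\<lambda>_::'n. exterior1 r" by (rule product_sigma_finite_exterior1) fact
  show ?case by (simp add: F PiM_empty lebesgue_integral_count_space_finite)
next
  case (Cons \<alpha> \<alpha>s)
  interpret product_sigma_finite "\<lambda>_::'n. exterior1 r" by (rule product_sigma_finite_exterior1) fact
  let ?P = "\<lambda>I. Pi\<^sub>M I (\<lambda>_::'n. exterior1 r)"
  have notin: "\<alpha> \<notin> set \<alpha>s" and dist: "distinct \<alpha>s" using Cons.prems by auto
  interpret fin: finite_measure "?P (set \<alpha>s)" by (rule finite_measure_PiM_exterior1[OF r]) simp
  interpret fin': finite_measure "?P (insert \<alpha> (set \<alpha>s))" by (rule finite_measure_PiM_exterior1[OF r]) simp
  have [measurable]: "K \<in> borel_measurable borel" using K(1) by (rule borel_measurable_continuous_onI)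
  have [measurable]: "Arg \<in> borel_measurable (exterior1 r)" by (rule Arg_measurable_exterior1)
  define \<theta>' where "\<theta>' s = (\<chi> i. if i = \<alpha> then s else \<theta> $ i)" for s
  define J where "J s = (\<integral>x. K (\<chi> i. if i \<in> set \<alpha>s then Arg (x i) else \<theta>' s $ i) \<partial>?P (set \<alpha>s))" for s
  define k where "k x = K (\<chi> i. if i \<in> insert \<alpha> (set \<alpha>s) then Arg (x i) else \<theta> $ i)" for x
  define c where "c = (2 * pi * \<i>) ^ length \<alpha>s / (\<Prod>i\<in>- set (\<alpha> # \<alpha>s). rcis r (\<theta> $ i))"
  have Arg_comp [measurable]: "(\<lambda>x. Arg (x i)) \<in> borel_measurable (?P I)" if "i \<in> I" for i I
    using that by measurable
  have J_meas [measurable]: "J \<in> borel_measurable borel"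
  proof -
    have "(\<lambda>(s, x). K (\<chi> i. if i \<in> set \<alpha>s then Arg (x i) else \<theta>' s $ i))
        \<in> borel_measurable (borel \<Otimes>\<^sub>M ?P (set \<alpha>s))"
    proof -
      have "(\<lambda>p. \<chi> i. if i \<in> set \<alpha>s then Arg (snd p i) else \<theta>' (fst p) $ i)
          \<in> borel_measurable (borel \<Otimes>\<^sub>M ?P (set \<alpha>s))"
      proof (rule borel_measurable_vec_lambda)
        fix i
        show "(\<lambda>p. if i \<in> set \<alpha>s then Arg (snd p i) else \<theta>' (fst p) $ i)
           \<in> borel_measurable (borel \<Otimes>\<^sub>M ?P (set \<alpha>s))"
        proof (cases "i \<in> set \<alpha>s")
          case True
          then show ?thesis using measurable_compose[OF measurable_snd Arg_comp[OF True]] by simp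
        next
          case False then show ?thesis by (cases "i = \<alpha>") (auto simp: \<theta>'_def)
        qed
      qed
      then have "(\<lambda>p. K (\<chi> i. if i \<in> set \<alpha>s then Arg (snd p i) else \<theta>' (fst p) $ i))
          \<in> borel_measurable (borel \<Otimes>\<^sub>M ?P (set \<alpha>s))"
        by (rule measurable_compose) measurable
      then show ?thesis by (simp add: case_prod_beta)
    qed
    then show ?thesis unfolding J_def by (intro fin.borel_measurable_lebesgue_integral) auto
  qed
  have J_bdd: "norm (J s) \<le> B * measure (?P (set \<alpha>s)) (space (?P (set \<alpha>s)))" for s
    unfolding J_def
  proof (rule order_trans[OF integral_norm_bound])
    let ?f = "\<lambda>x. norm (K (\<chi> i. if i \<in> set \<alpha>s then Arg (x i) else \<theta>' s $ i))"
    have "B \<ge> 0" using order_trans[OF norm_ge_zero K(2)] .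
    then show "(\<integral>x. ?f x \<partial>?P (set \<alpha>s)) \<le> B * measure (?P (set \<alpha>s)) (space (?P (set \<alpha>s)))"
    proof (cases "integrable (?P (set \<alpha>s)) ?f")
      case True
      then have "(\<integral>x. ?f x \<partial>?P (set \<alpha>s)) \<le> (\<integral>x. B \<partial>?P (set \<alpha>s))"
        by (rule integral_mono) (simp_all add: K(2))
      then show ?thesis by (simp add: mult.commute)
    qed (simp add: not_integrable_integral_eq)
  qed
  have upd: "(\<chi> \<beta>. if \<beta> = \<alpha> then rcis r s else (\<chi> i. rcis r (\<theta> $ i)) $ \<beta>)
      = (\<chi> i. rcis r (\<theta>' s $ i))" for s
    by (auto simp: vec_eq_iff \<theta>'_def)
  have prod: "(\<Prod>i\<in>- set \<alpha>s. rcis r (\<theta>' s $ i))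
      = rcis r s * (\<Prod>i\<in>- set (\<alpha> # \<alpha>s). rcis r (\<theta> $ i))" for s
  proof -
    have "- set \<alpha>s = insert \<alpha> (- set (\<alpha> # \<alpha>s))" using notin by auto
    then have "(\<Prod>i\<in>- set \<alpha>s. rcis r (\<theta>' s $ i))
        = rcis r (\<theta>' s $ \<alpha>) * (\<Prod>i\<in>- set (\<alpha> # \<alpha>s). rcis r (\<theta>' s $ i))"
      by (simp only:) (rule prod.insert; simp)
    also have "(\<Prod>i\<in>- set (\<alpha> # \<alpha>s). rcis r (\<theta>' s $ i)) = (\<Prod>i\<in>- set (\<alpha> # \<alpha>s). rcis r (\<theta> $ i))"
      by (rule prod.cong) (auto simp: \<theta>'_def)
    finally show ?thesis by (simp add: \<theta>'_def)
  qed
  have inner: "iterated_contour r \<alpha>s (\<lambda>w. F w / (\<Prod>\<alpha>\<in>UNIV. w $ \<alpha>))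
         (\<chi> \<beta>. if \<beta> = \<alpha> then rcis r s else (\<chi> i. rcis r (\<theta> $ i)) $ \<beta>) * (\<i> * rcis r s)
      = c * \<i> * J s" for s
    unfolding upd Cons.IH[OF dist] prod c_def J_def using r by (simp add: field_simps)
  have "(J has_integral integral {-pi..pi} J) {-pi..pi}"
    using bounded_measurable_integrable_on[OF J_meas J_bdd] by (rule integrable_integral)
  then have "((\<lambda>s. c * \<i> * J s) has_integral c * \<i> * integral {-pi..pi} J) {-pi..pi}"
    by (rule has_integral_mult_right)
  then have "iterated_contour r (\<alpha> # \<alpha>s) (\<lambda>w. F w / (\<Prod>\<alpha>\<in>UNIV. w $ \<alpha>)) (\<chi> i. rcis r (\<theta> $ i))
      = c * \<i> * integral {-pi..pi} J"
    unfolding iterated_contour.simps by (intro circle_contour_integral) (simp only: inner)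
  also have "\<dots> = 2 * pi * \<i> * c * (\<integral>y. J (Arg y) \<partial>exterior1 r)"
    unfolding exterior1_integral[OF r J_meas J_bdd] by simp
  also have "(\<integral>y. J (Arg y) \<partial>exterior1 r) = (\<integral>x. k x \<partial>?P (insert \<alpha> (set \<alpha>s)))"
  proof -
    have k_meas: "k \<in> borel_measurable (?P (insert \<alpha> (set \<alpha>s)))"
      unfolding k_def
    proof (rule measurable_compose[OF borel_measurable_vec_lambda])
      fix i show "(\<lambda>x. if i \<in> insert \<alpha> (set \<alpha>s) then Arg (x i) else \<theta> $ i)
          \<in> borel_measurable (?P (insert \<alpha> (set \<alpha>s)))"
        by (cases "i \<in> insert \<alpha> (set \<alpha>s)") (simp_all only: if_True if_False Arg_comp borel_measurable_const)
    qed measurable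
    have "integrable (?P (insert \<alpha> (set \<alpha>s))) k"
      using k_meas by (intro fin'.integrable_const_bound[of _ B]) (simp_all add: k_def K(2))
    then have "(\<integral>x. k x \<partial>?P (insert \<alpha> (set \<alpha>s)))
        = (\<integral>u. (\<integral>x. k (merge {\<alpha>} (set \<alpha>s) (u, x)) \<partial>?P (set \<alpha>s)) \<partial>?P {\<alpha>})"
      using product_integral_fold[of "{\<alpha>}" "set \<alpha>s" k] notin by simp
    also have "\<dots> = (\<integral>u. J (Arg (u \<alpha>)) \<partial>?P {\<alpha>})"
    proof -
      have "k (merge {\<alpha>} (set \<alpha>s) (u, x))
          = K (\<chi> i. if i \<in> set \<alpha>s then Arg (x i) else \<theta>' (Arg (u \<alpha>)) $ i)" for u x
        unfolding k_def by (rule arg_cong[of _ _ K]) (use notin in \<open>auto simp: vec_eq_iff merge_def \<theta>'_def\<close>)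
      then show ?thesis by (simp add: J_def)
    qed
    also have "\<dots> = (\<integral>y. J (Arg y) \<partial>exterior1 r)"
      by (rule product_integral_singleton) measurable
    finally show ?thesis by simp
  qed
  finally show ?case by (simp add: c_def k_def)
qed

lemma space_exterior [simp]: "space (exterior r) = polydisc r"
  by (simp add: exterior_def)

lemma vec_lambda_measurable_exterior:
  "vec_lambda \<in> measurable (Pi\<^sub>M UNIV (\<lambda>_. exterior1 r)) (exterior r)"
proof -
  have "vec_lambda \<in> measurable (Pi\<^sub>M UNIV (\<lambda>_. exterior1 r))
      (vimage_algebra (polydisc r) vec_nth (Pi\<^sub>M UNIV (\<lambda>_. exterior1 r)))"
    by (rule measurable_vimage_algebra2)
       (auto simp: space_PiM polydisc_def PiE_iff vec_lambda_inverse)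
  then show ?thesis by (simp add: exterior_def cong: measurable_cong_sets)
qed

lemma integral_exterior:
  fixes f :: "complex^'n \<Rightarrow> complex"
  assumes "f \<in> borel_measurable (exterior r)"
  shows "(\<integral>w. f w \<partial>exterior r) = (\<integral>x. f (vec_lambda x) \<partial>Pi\<^sub>M UNIV (\<lambda>_. exterior1 r))"
proof -
  have "(\<integral>w. f w \<partial>exterior r)
      = (\<integral>w. f w \<partial>distr (Pi\<^sub>M UNIV (\<lambda>_. exterior1 r)) (exterior r) vec_lambda)"
    by (rule Bochner_Integration.integral_cong) (auto simp: exterior_def cong: distr_cong)
  also have "\<dots> = (\<integral>x. f (vec_lambda x) \<partial>Pi\<^sub>M UNIV (\<lambda>_. exterior1 r))"
    by (rule integral_distr[OF vec_lambda_measurable_exterior assms])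
  finally show ?thesis .
qed

lemma emeasure_exterior_space:
  assumes "r > 0" shows "emeasure (exterior r) (polydisc r :: (complex^'n) set) = 1"
proof -
  interpret product_sigma_finite "\<lambda>_::'n. exterior1 r" by (rule product_sigma_finite_exterior1) fact
  let ?M = "Pi\<^sub>M UNIV (\<lambda>_::'n. exterior1 r)"
  have "emeasure (exterior r) (polydisc r :: (complex^'n) set)
      = emeasure (distr ?M (exterior r) vec_lambda) (space (exterior r))"
    by (auto simp: exterior_def cong: distr_cong)
  also have "\<dots> = emeasure ?M (space ?M)"
    using measurable_space[OF vec_lambda_measurable_exterior]
    by (subst emeasure_distr[OF vec_lambda_measurable_exterior sets.top])
       (auto intro!: arg_cong[of _ _ "emeasure ?M"])
  also have "\<dots> = (\<Prod>i\<in>(UNIV::'n set). emeasure (exterior1 r) (space (exterior1 r)))"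
    unfolding space_PiM by (rule emeasure_PiM[OF finite]) (rule sets.top)
  finally show ?thesis by (simp add: prob_space_exterior1[OF assms] del: space_exterior1)
qed

lemma Arg_component_measurable_exterior:
  "(\<lambda>w. Arg (w $ i)) \<in> borel_measurable (exterior r)"
proof -
  have "vec_nth \<in> measurable (vimage_algebra (polydisc r) vec_nth (Pi\<^sub>M UNIV (\<lambda>_. exterior1 r)))
      (Pi\<^sub>M UNIV (\<lambda>_. exterior1 r))"
    by (rule measurable_vimage_algebra1) (auto simp: space_PiM polydisc_def PiE_iff)
  then have "vec_nth \<in> measurable (exterior r) (Pi\<^sub>M UNIV (\<lambda>_. exterior1 r))"
    by (simp add: exterior_def cong: measurable_cong_sets)
  moreover have "(\<lambda>x. Arg (x i)) \<in> borel_measurable (Pi\<^sub>M UNIV (\<lambda>_. exterior1 r))"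
    by (rule measurable_compose[OF _ Arg_measurable_exterior1]) (rule measurable_component_singleton[OF UNIV_I])
  ultimately show ?thesis by (rule measurable_compose)
qed

lemma compact_torus: "compact {w :: complex^'n. \<forall>\<alpha>. cmod (w $ \<alpha>) = r}"
  unfolding compact_eq_bounded_closed
proof
  have "norm w \<le> (\<Sum>\<alpha>\<in>(UNIV::'n set). r)" if "\<forall>\<alpha>. cmod (w $ \<alpha>) = r" for w :: "complex^'n"
  proof -
    have "norm w \<le> (\<Sum>\<alpha>\<in>UNIV. norm (w $ \<alpha>))"
      unfolding norm_vec_def by (rule L2_set_le_sum) simp
    then show ?thesis using that by simp
  qed
  then show "bounded {w :: complex^'n. \<forall>\<alpha>. cmod (w $ \<alpha>) = r}" unfolding bounded_iff by blast
  show "closed {w :: complex^'n. \<forall>\<alpha>. cmod (w $ \<alpha>) = r}"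
    by (intro closed_Collect_all closed_Collect_eq continuous_intros)
qed

lemma boundary_integral:
  fixes F :: "complex^'n \<Rightarrow> complex"
  assumes r: "r > 0" and F: "continuous_on {w. \<forall>\<alpha>. cmod (w $ \<alpha>) = r} F"
  shows "(\<lambda>w. F (boundary_point r w)) \<in> borel_measurable (exterior r)" (is ?meas)
    and "polydisc_contour r (\<lambda>w. F w / (\<Prod>\<alpha>\<in>UNIV. w $ \<alpha>)) / (2 * pi * \<i>) ^ CARD('n)
           = (\<integral>w. F (boundary_point r w) \<partial>exterior r)"
proof -
  define K where "K \<theta> = F (\<chi> i. rcis r (\<theta> $ i))" for \<theta> :: "real^'n"
  have mem: "(\<chi> i. rcis r (\<theta> $ i)) \<in> {w. \<forall>\<alpha>. cmod (w $ \<alpha>) = r}" for \<theta> :: "real^'n"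
    using r by simp
  have contK: "continuous_on UNIV K"
    unfolding K_def
  proof (rule continuous_on_compose2[OF F])
    show "continuous_on UNIV (\<lambda>\<theta>::real^'n. \<chi> i. rcis r (\<theta> $ i))"
      unfolding rcis_def cis_conv_exp by (intro continuous_intros)
  qed (use mem in blast)
  have "bounded (F ` {w. \<forall>\<alpha>. cmod (w $ \<alpha>) = r})"
    by (intro compact_imp_bounded compact_continuous_image F compact_torus)
  then obtain B where "\<And>w. w \<in> {w. \<forall>\<alpha>. cmod (w $ \<alpha>) = r} \<Longrightarrow> norm (F w) \<le> B"
    unfolding bounded_iff by blast
  then have B: "norm (K \<theta>) \<le> B" for \<theta> unfolding K_def using mem by blast
  have bp: "F (boundary_point r w) = K (\<chi> i. Arg (w $ i))" for w
    by (simp add: K_def boundary_point_def)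
  show ?meas unfolding bp
    by (rule measurable_compose[OF borel_measurable_vec_lambda[OF Arg_component_measurable_exterior]])
       (rule borel_measurable_continuous_onI[OF contK])
  define \<alpha>s :: "'n list" where "\<alpha>s = (SOME \<alpha>s. distinct \<alpha>s \<and> set \<alpha>s = UNIV)"
  have "\<exists>\<alpha>s :: 'n list. distinct \<alpha>s \<and> set \<alpha>s = UNIV"
    using finite_distinct_list[of "UNIV :: 'n set"] by auto
  then have "distinct \<alpha>s \<and> set \<alpha>s = UNIV" unfolding \<alpha>s_def by (rule someI_ex)
  then have \<alpha>s: "distinct \<alpha>s" "set \<alpha>s = UNIV" "length \<alpha>s = CARD('n)"
    using distinct_card[of \<alpha>s] by auto
  have "polydisc_contour r (\<lambda>w. F w / (\<Prod>\<alpha>\<in>UNIV. w $ \<alpha>))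
      = iterated_contour r \<alpha>s (\<lambda>w. F w / (\<Prod>\<alpha>\<in>UNIV. w $ \<alpha>)) (\<chi> i. rcis r ((0::real^'n) $ i))"
    unfolding polydisc_contour_def \<alpha>s_def[symmetric] by (rule iterated_contour_cong) (simp add: \<alpha>s)
  also have "\<dots> = (2 * pi * \<i>) ^ CARD('n) *
      (\<integral>x. K (\<chi> i. Arg (x i)) \<partial>Pi\<^sub>M UNIV (\<lambda>_. exterior1 r))"
    using iterated_contour_eq_integral[OF r contK B _ \<alpha>s(1), of F 0] \<alpha>s by (simp add: K_def)
  also have "(\<integral>x. K (\<chi> i. Arg (x i)) \<partial>Pi\<^sub>M UNIV (\<lambda>_. exterior1 r))
      = (\<integral>w. F (boundary_point r w) \<partial>exterior r)"
    by (subst integral_exterior) (use \<open>?meas\<close> in \<open>simp_all add: bp\<close>)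
  finally show "polydisc_contour r (\<lambda>w. F w / (\<Prod>\<alpha>\<in>UNIV. w $ \<alpha>)) / (2 * pi * \<i>) ^ CARD('n)
           = (\<integral>w. F (boundary_point r w) \<partial>exterior r)" by simp
qed

lemma unit_lens_eq_distr:
  fixes z :: "'m \<Rightarrow> complex^'n"
  assumes inj: "inj_on z U" and r: "r \<in> scales U z"
  defines "V \<equiv> vimage_algebra (lens_disc U z r) z (exterior r)"
  shows "unit_lens U z r = distr (exterior r) V (inv_into U z)"
    and "inv_into U z \<in> measurable (exterior r) V"
    and "space V = lens_disc U z r"
proof -
  have sub: "polydisc r \<subseteq> z ` U" using r by (simp add: scales_def)
  have zS: "z \<in> lens_disc U z r \<rightarrow> space (exterior r)" by (auto simp: lens_disc_def)
  show meas: "inv_into U z \<in> measurable (exterior r) V" unfolding V_def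
  proof (rule measurable_vimage_algebra2)
    show "inv_into U z \<in> space (exterior r) \<rightarrow> lens_disc U z r"
      using sub by (auto simp: lens_disc_def f_inv_into_f inv_into_into subset_eq)
    show "(\<lambda>w. z (inv_into U z w)) \<in> measurable (exterior r) (exterior r)"
      using sub by (subst measurable_cong[where g = "\<lambda>w. w"]) (auto simp: f_inv_into_f subset_eq)
  qed
  show V: "space V = lens_disc U z r" by (simp add: V_def)
  have sets_V: "sets V = {z -` B \<inter> lens_disc U z r | B. B \<in> sets (exterior r)}"
    unfolding V_def by (rule sets_vimage_algebra2[OF zS])
  have "emeasure (distr (exterior r) V (inv_into U z)) A = emeasure (exterior r) (z ` A)"
    if A: "A \<in> sets V" for A
  proof -
    have AU: "A \<subseteq> U" "z ` A \<subseteq> polydisc r"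
      using sets.sets_into_space[OF A] unfolding V by (auto simp: lens_disc_def)
    have "inv_into U z -` A \<inter> polydisc r = z ` A"
      using AU sub inj by (auto simp: image_iff subset_eq) (metis f_inv_into_f image_eqI)
    then show ?thesis by (simp add: emeasure_distr[OF meas A])
  qed
  then have "measure_of (space V) (sets V) (\<lambda>A. emeasure (exterior r) (z ` A))
      = measure_of (space V) (sets V) (emeasure (distr (exterior r) V (inv_into U z)))"
    by (intro measure_of_eq) (auto simp: sets.space_closed sets.sigma_sets_eq)
  also have "\<dots> = distr (exterior r) V (inv_into U z)"
    using measure_of_of_measure[of "distr (exterior r) V (inv_into U z)"] by simp
  finally show "unit_lens U z r = distr (exterior r) V (inv_into U z)"
    unfolding unit_lens_def V sets_V .
qed

lemma emeasure_unit_lens_space: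
  assumes "inj_on z U" and r: "r \<in> scales U z"
  shows "emeasure (unit_lens U z r) (lens_disc U z r) = 1"
proof -
  note l = unit_lens_eq_distr[OF assms]
  have "inv_into U z -` lens_disc U z r \<inter> space (exterior r) = polydisc r"
    using measurable_space[OF l(2)] l(3) by auto
  then show ?thesis
    using r emeasure_distr[OF l(2) sets.top] emeasure_exterior_space[of r]
    unfolding l(1,3) by (simp add: scales_def)
qed

lemma contour_eq_unit_lens_integral:
  fixes z :: "'m \<Rightarrow> complex^'n" and \<psi> :: "'m \<Rightarrow> complex"
  assumes inj: "inj_on z U" and r: "r \<in> scales U z"
    and "continuous_on {w. \<forall>\<alpha>. cmod (w $ \<alpha>) = r} (coord_rep U z \<psi>)"
  shows "polydisc_contour r (\<lambda>w. coord_rep U z \<psi> w / (\<Prod>\<alpha>\<in>UNIV. w $ \<alpha>)) / (2 * pi * \<i>) ^ CARD('n)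
           = (\<integral>p. boundary_trace U z \<psi> r p \<partial>unit_lens U z r)"
proof -
  have r0: "r > 0" and sub: "polydisc r \<subseteq> z ` U" using r by (auto simp: scales_def)
  note l = unit_lens_eq_distr[OF inj r]
  note b = boundary_integral[OF r0 assms(3)]
  have zV: "z \<in> measurable (vimage_algebra (lens_disc U z r) z (exterior r)) (exterior r)"
    by (rule measurable_vimage_algebra1) (auto simp: lens_disc_def)
  have "boundary_trace U z \<psi> r = (\<lambda>p. coord_rep U z \<psi> (boundary_point r (z p)))"
    by (simp add: fun_eq_iff boundary_trace_def coord_rep_def)
  then have "boundary_trace U z \<psi> r \<in> borel_measurable (vimage_algebra (lens_disc U z r) z (exterior r))"
    using measurable_compose[OF zV b(1)] by simp
  then have "(\<integral>p. boundary_trace U z \<psi> r p \<partial>unit_lens U z r)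
      = (\<integral>w. boundary_trace U z \<psi> r (inv_into U z w) \<partial>exterior r)"
    unfolding l(1) by (rule integral_distr[OF l(2)])
  also have "\<dots> = (\<integral>w. coord_rep U z \<psi> (boundary_point r w) \<partial>exterior r)"
    using sub by (intro Bochner_Integration.integral_cong refl)
      (auto simp: boundary_trace_def coord_rep_def f_inv_into_f subset_eq)
  finally show ?thesis using b(2) by simp
qed

text \<open>
  \<open>E(\<psi>) = \<integral> \<psi> d\<nu>\<close> and \<open>\<langle>\<psi>, \<phi>\<rangle> = \<integral> \<psi>\<^sup>* \<phi> d\<nu>\<close>, the integrals being taken over boundary values.
\<close>

theorem expectation_eq_unit_lens_integral:
  assumes "inj_on z U" "r \<in> scales U z"
    and "continuous_on {w. \<forall>\<alpha>. cmod (w $ \<alpha>) = r} (coord_rep U z \<psi>)"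
  shows "expectation U z \<psi> r $ a = (\<integral>p. boundary_trace U z \<psi> r p $ a \<partial>unit_lens U z r)"
proof -
  have "continuous_on {w. \<forall>\<alpha>. cmod (w $ \<alpha>) = r} (coord_rep U z (\<lambda>p. \<psi> p $ a))"
    using continuous_on_component[OF assms(3)] by (simp add: coord_rep_def comp_def)
  from contour_eq_unit_lens_integral[OF assms(1,2) this] show ?thesis
    by (simp add: expectation_def coord_rep_def comp_def boundary_trace_def)
qed

theorem lens_inner_eq_unit_lens_integral:
  assumes "inj_on z U" "r \<in> scales U z"
    and "continuous_on {w. \<forall>\<alpha>. cmod (w $ \<alpha>) = r} (coord_rep U z \<psi>)"
    and "continuous_on {w. \<forall>\<alpha>. cmod (w $ \<alpha>) = r} (coord_rep U z \<phi>)"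
  shows "lens_inner U z \<psi> \<phi> r =
    (\<integral>p. (\<Sum>a\<in>UNIV. cnj (boundary_trace U z \<psi> r p $ a) * boundary_trace U z \<phi> r p $ a) \<partial>unit_lens U z r)"
proof -
  have "continuous_on {w. \<forall>\<alpha>. cmod (w $ \<alpha>) = r} (coord_rep U z (\<lambda>p. \<Sum>a\<in>UNIV. cnj (\<psi> p $ a) * \<phi> p $ a))"
    using assms(3,4) unfolding coord_rep_def comp_def by (intro continuous_intros)
  from contour_eq_unit_lens_integral[OF assms(1,2) this] show ?thesis
    by (simp add: lens_inner_def coord_rep_def comp_def boundary_trace_def)
qed

end

(*
  The mean of a function over the torus |w_1| = ... = |w_n| = r annihilates every monomial
  w^a cnj(w)^b with a \<noteq> b, and 1 / w_\<beta> = cnj(w_\<beta>) / r^2 there.  Hence in the decomposition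
  \<psi> = h(0) + (\<Sum>\<beta>. \<eta>_\<beta> / w_\<beta>) + D w + g, with g holomorphic of order at least two, the four
  parts are orthogonal and the variance at scale r is
    Tr(\<eta>* \<eta>) / r^2 + r^2 Tr(D* D) + (mean of |g|^2),
  where the last term is nonnegative and O(r^4).  The first bound drops the last two terms; without g,
  the remaining two-term sum is smallest where r^4 = Tr(\<eta>* \<eta>) / Tr(D* D).
*)
theory Submission
  imports Defs
begin

section \<open>Holomorphic functions of several variables\<close>

text \<open>Several variables are handled through complex lines: complex-linearity of the Frechet
  derivative makes t \<mapsto> f (p + t q) holomorphic in one variable. Coordinate lines give the
  iterated Cauchy formula; lines through the centre give the identity theorem and the quadratic
  bound on g. The contour integrals are rewritten as integrals against the probability
  \<open>exterior r\<close>, because there conjugation, positivity and norm bounds are immediate,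
  while dw/w behaves badly under conjugation. Two means then carry all the orthogonality: a
  holomorphic f has mean f(0), and f cnj(w_\<beta>) has mean r^2 times the \<beta>-th partial
  derivative of f at 0. The core, the residues and the Jacobian, although defined by contours at
  some scale, are identified with data of \<eta> and h. They are therefore the same at every scale,
  which is what allows the variance to be minimised over r with \<eta> and D held fixed.\<close>

definition holomorphic_fun_on :: "(complex^'n \<Rightarrow> complex) \<Rightarrow> (complex^'n) set \<Rightarrow> bool" where
  "holomorphic_fun_on f S \<longleftrightarrow>
     (\<forall>w\<in>S. \<exists>f'. (f has_derivative f') (at w) \<and> (\<forall>c v. f' (c *s v) = c * f' v))"

text \<open>Components take values in a field, so products with linear forms become available; the
  orthogonality arguments depend on them.\<close>

lemma holomorphic_map_on_component:
  assumes "holomorphic_map_on h S"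
  shows "holomorphic_fun_on (\<lambda>w. h w $ a) S"
  unfolding holomorphic_fun_on_def
proof
  fix w assume "w \<in> S"
  then obtain h' where "(h has_derivative h') (at w)" "\<forall>c v. h' (c *s v) = c *s h' v"
    using assms by (auto simp: holomorphic_map_on_def)
  then show "\<exists>f'. ((\<lambda>w. h w $ a) has_derivative f') (at w) \<and> (\<forall>c v. f' (c *s v) = c * f' v)"
    by (intro exI[of _ "\<lambda>v. h' v $ a"])
      (auto intro: bounded_linear.has_derivative[OF bounded_linear_vec_nth])
qed

lemma holomorphic_map_on_continuous:
  assumes "holomorphic_map_on h S"
  shows "continuous_on S h"
  using assms unfolding holomorphic_map_on_def
  by (meson continuous_at_imp_continuous_on has_derivative_continuous)

lemma holomorphic_fun_on_continuous:
  assumes "holomorphic_fun_on f S"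
  shows "continuous_on S f"
  using assms unfolding holomorphic_fun_on_def
  by (meson continuous_at_imp_continuous_on has_derivative_continuous)

lemma holomorphic_fun_on_const [intro]: "holomorphic_fun_on (\<lambda>w. c) S"
  unfolding holomorphic_fun_on_def
  by (intro ballI exI[of _ "\<lambda>v. 0"]) (auto intro!: derivative_eq_intros)

lemma holomorphic_fun_on_nth [intro]: "holomorphic_fun_on (\<lambda>w. w $ \<beta>) S"
  unfolding holomorphic_fun_on_def
  by (intro ballI exI[of _ "\<lambda>v. v $ \<beta>"])
    (auto intro: bounded_linear_imp_has_derivative bounded_linear_vec_nth)

lemma holomorphic_fun_on_add [intro]:
  assumes "holomorphic_fun_on f S" "holomorphic_fun_on g S"
  shows "holomorphic_fun_on (\<lambda>w. f w + g w) S"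
  unfolding holomorphic_fun_on_def
proof
  fix w assume "w \<in> S"
  then obtain f' g' where
    "(f has_derivative f') (at w)" "\<forall>c v. f' (c *s v) = c * f' v"
    "(g has_derivative g') (at w)" "\<forall>c v. g' (c *s v) = c * g' v"
    using assms unfolding holomorphic_fun_on_def by metis
  then show "\<exists>h'. ((\<lambda>w. f w + g w) has_derivative h') (at w) \<and> (\<forall>c v. h' (c *s v) = c * h' v)"
    by (intro exI[of _ "\<lambda>v. f' v + g' v"]) (auto intro: has_derivative_add simp: algebra_simps)
qed

lemma holomorphic_fun_on_mult [intro]:
  assumes "holomorphic_fun_on f S" "holomorphic_fun_on g S"
  shows "holomorphic_fun_on (\<lambda>w. f w * g w) S"
  unfolding holomorphic_fun_on_def
proof
  fix w assume "w \<in> S"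
  then obtain f' g' where
    "(f has_derivative f') (at w)" "\<forall>c v. f' (c *s v) = c * f' v"
    "(g has_derivative g') (at w)" "\<forall>c v. g' (c *s v) = c * g' v"
    using assms unfolding holomorphic_fun_on_def by metis
  then show "\<exists>h'. ((\<lambda>w. f w * g w) has_derivative h') (at w) \<and> (\<forall>c v. h' (c *s v) = c * h' v)"
    by (intro exI[of _ "\<lambda>v. f w * g' v + f' v * g w"])
      (auto intro: has_derivative_mult simp: algebra_simps)
qed

lemma holomorphic_fun_on_diff [intro]:
  assumes "holomorphic_fun_on f S" "holomorphic_fun_on g S"
  shows "holomorphic_fun_on (\<lambda>w. f w - g w) S"
  using holomorphic_fun_on_add[OF assms(1) holomorphic_fun_on_mult[OF holomorphic_fun_on_const[of "-1"] assms(2)]]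
  by simp

lemma holomorphic_fun_on_sum [intro]:
  assumes "\<And>i. i \<in> I \<Longrightarrow> holomorphic_fun_on (f i) S"
  shows "holomorphic_fun_on (\<lambda>w. \<Sum>i\<in>I. f i w) S"
  using assms by (induction I rule: infinite_finite_induct) auto

text \<open>By the chain rule the derivative in t is t \<mapsto> f' (t q); complex-linearity turns
  this into multiplication by the number f' q, as a field derivative requires.\<close>

lemma has_field_derivative_along_line:
  fixes f :: "complex^'n \<Rightarrow> complex"
  assumes "(f has_derivative f') (at (p + t *s q))" and "\<And>c v. f' (c *s v) = c * f' v"
  shows "((\<lambda>t. f (p + t *s q)) has_field_derivative f' q) (at t)"
proof -
  have "bounded_linear (\<lambda>t. t *s q)"
    by (intro linear_conv_bounded_linear[THEN iffD1] linearI)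
      (auto simp: vec_eq_iff algebra_simps)
  then have "((\<lambda>t. p + t *s q) has_derivative (\<lambda>t. t *s q)) (at t)"
    by (auto intro!: derivative_eq_intros bounded_linear_imp_has_derivative)
  from has_derivative_compose[OF this assms(1)]
  show ?thesis
    unfolding has_field_derivative_def by (simp add: assms(2) mult.commute[of _ "f' q"] cong: if_cong)
qed

lemma open_line_vimage:
  fixes V :: "(complex^'n) set"
  assumes "open V"
  shows "open {t. p + t *s q \<in> V}"
proof -
  have "continuous_on UNIV (\<lambda>t. p + t *s q)"
    unfolding vector_scalar_mult_def by (intro continuous_intros)
  then show ?thesis using open_vimage[OF assms, of "\<lambda>t. p + t *s q"] by (simp add: vimage_def)
qed

lemma holomorphic_fun_on_line:
  assumes "holomorphic_fun_on f V"
  shows "(\<lambda>t. f (p + t *s q)) holomorphic_on {t. p + t *s q \<in> V}"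
proof (rule holomorphic_onI)
  fix t assume "t \<in> {t. p + t *s q \<in> V}"
  then obtain f' where "(f has_derivative f') (at (p + t *s q))" "\<And>c v. f' (c *s v) = c * f' v"
    using assms unfolding holomorphic_fun_on_def by blast
  from has_field_derivative_along_line[OF this]
  show "(\<lambda>t. f (p + t *s q)) field_differentiable at t within {t. p + t *s q \<in> V}"
    using field_differentiable_at_within field_differentiable_def by blast
qed

section \<open>Polydiscs and the discs through their centre\<close>

lemma polydisc_scale:
  assumes "w \<in> polydisc r" "cmod t \<le> 1"
  shows "t *s w \<in> polydisc r"
  using assms mult_mono[of "cmod t" 1] by (fastforce simp: polydisc_def norm_mult)

text \<open>Polydiscs are balanced, so the line through w stays inside for all |t| \<le> 1,
  including t = 1, where w itself is reached.\<close>

lemma holomorphic_fun_on_radial: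
  assumes "holomorphic_fun_on f V" "polydisc r \<subseteq> V" "w \<in> polydisc r"
  shows "(\<lambda>t. f (t *s w)) holomorphic_on cball 0 1"
proof -
  have "(\<lambda>t. f (0 + t *s w)) holomorphic_on cball 0 1"
    by (rule holomorphic_on_subset[OF holomorphic_fun_on_line[OF assms(1)]])
      (use polydisc_scale[OF assms(3)] assms(2) in auto)
  then show ?thesis by simp
qed

lemma polydisc_mono: "r \<le> s \<Longrightarrow> polydisc r \<subseteq> polydisc s"
  by (auto simp: polydisc_def intro: order_trans)

lemma zero_in_polydisc: "r \<ge> 0 \<Longrightarrow> 0 \<in> polydisc r"
  by (simp add: polydisc_def)

lemma compact_polydisc: "compact (polydisc r :: (complex^'n) set)"
  unfolding compact_eq_bounded_closed
proof
  have "norm w \<le> (\<Sum>\<alpha>\<in>(UNIV::'n set). r)" if "w \<in> polydisc r" for w :: "complex^'n"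
  proof -
    have "norm w \<le> (\<Sum>\<alpha>\<in>UNIV. norm (w $ \<alpha>))"
      unfolding norm_vec_def by (rule L2_set_le_sum) simp
    also have "\<dots> \<le> (\<Sum>\<alpha>\<in>(UNIV::'n set). r)"
      using that by (intro sum_mono) (simp add: polydisc_def)
    finally show ?thesis .
  qed
  then show "bounded (polydisc r :: (complex^'n) set)" unfolding bounded_iff by blast
  show "closed (polydisc r :: (complex^'n) set)"
    unfolding polydisc_def by (intro closed_Collect_all closed_Collect_le continuous_intros)
qed

text \<open>Along t \<mapsto> t w the function vanishes near t = 0, hence on the open unit disc by
  the one-variable identity theorem. The point w sits at t = 1 on the boundary, so its value comes
  from continuity.\<close>

lemma holomorphic_fun_on_identity:
  assumes f: "holomorphic_fun_on f V" and V: "open V" and sub: "polydisc r \<subseteq> V"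
    and zero: "\<forall>\<^sub>F w in nhds 0. f w = 0" and w: "w \<in> polydisc r"
  shows "f w = 0"
proof -
  define \<phi> where "\<phi> t = f (t *s w)" for t
  have hol: "\<phi> holomorphic_on cball 0 1"
    unfolding \<phi>_def by (rule holomorphic_fun_on_radial[OF f sub w])
  have "((\<lambda>t. t *s w) \<longlongrightarrow> 0 *s w) (nhds 0)"
    unfolding vector_scalar_mult_def by (intro tendsto_intros filterlim_ident)
  then have "\<forall>\<^sub>F t in nhds 0. \<phi> t = 0"
    unfolding \<phi>_def using zero by (auto simp: filterlim_iff)
  then obtain S where S: "open S" "0 \<in> S" "\<And>t. t \<in> S \<Longrightarrow> \<phi> t = 0"
    unfolding eventually_nhds by blast
  have zero_ball: "\<phi> t = 0" if "t \<in> ball 0 1" for t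
    by (rule analytic_continuation_open[of "S \<inter> ball 0 1" "ball 0 1" \<phi> "\<lambda>_. 0"])
      (use S that hol in \<open>auto intro: holomorphic_on_subset\<close>)
  have "\<phi> 1 = 0"
    by (rule continuous_constant_on_closure[of "ball 0 1"])
      (use zero_ball holomorphic_on_imp_continuous_on[OF hol] in auto)
  then show ?thesis by (simp add: \<phi>_def)
qed

text \<open>The first-order Taylor polynomial at 0 is zero, so \<phi> is its own remainder,
  controlled by a bound on the second derivative over |x| \<le> 1/2. The restriction on t leaves
  room for Cauchy's estimate.\<close>

lemma second_order_bound_unit_disc:
  assumes hol: "\<phi> holomorphic_on cball 0 1" and bound: "\<And>t. t \<in> cball 0 1 \<Longrightarrow> cmod (\<phi> t) \<le> M"
    and zero: "\<phi> 0 = 0" "(\<phi> has_field_derivative 0) (at 0)" and t: "cmod t \<le> 1 / 2"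
  shows "cmod (\<phi> t) \<le> 8 * M * (cmod t)\<^sup>2"
proof -
  define g where "g i = (deriv ^^ i) \<phi>" for i :: nat
  have hol1: "\<phi> holomorphic_on ball 0 1" using hol by (auto intro: holomorphic_on_subset)
  have "cmod (g 0 t - (\<Sum>i\<le>1. g i 0 * (t - 0) ^ i / fact i)) \<le> 8 * M * cmod (t - 0) ^ Suc 1 / fact 1"
  proof (rule complex_Taylor[of "cball 0 (1/2)"])
    fix i x assume x: "x \<in> cball (0::complex) (1/2)"
    have "g i holomorphic_on ball 0 1" unfolding g_def by (rule holomorphic_higher_deriv[OF hol1]) auto
    then have "(g i has_field_derivative deriv (g i) x) (at x)"
      using x by (intro holomorphic_derivI[where S = "ball 0 1"]) auto
    then show "(g i has_field_derivative g (Suc i) x) (at x within cball 0 (1/2))"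
      by (auto simp: g_def intro: has_field_derivative_at_within)
  next
    fix x assume x: "x \<in> cball (0::complex) (1/2)"
    have sub: "cball x (1/2) \<subseteq> cball 0 1"
      using x by (simp add: cball_subset_cball_iff)
    \<comment> \<open>Cauchy's estimate on the disc of radius 1/2 about x, which lies in the unit
      disc: 2! M / (1/2)^2 = 8 M.\<close>
    have "cmod (g (Suc 1) x) \<le> fact (Suc 1) * M / (1/2) ^ Suc 1"
      unfolding g_def
    proof (rule Cauchy_inequality)
      show "\<phi> holomorphic_on ball x (1/2)"
        using hol sub ball_subset_cball by (blast intro: holomorphic_on_subset)
      show "continuous_on (cball x (1/2)) \<phi>"
        using holomorphic_on_imp_continuous_on[OF hol] sub by (rule continuous_on_subset)
      show "cmod (\<phi> y) \<le> M" if "cmod (x - y) = 1/2" for y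
        using that subsetD[OF sub, of y] by (intro bound) (auto simp: dist_norm)
    qed auto
    then show "cmod (g (Suc 1) x) \<le> 8 * M" by (simp add: fact_numeral)
  qed (use t in auto)
  moreover have "g 0 0 = 0" "g 1 0 = 0" using zero DERIV_imp_deriv by (auto simp: g_def)
  ultimately show ?thesis by (simp add: g_def power2_eq_square)
qed

text \<open>Uniformity in w comes from rescaling: w lies at parameter r / s \<le> 1/2 on the line
  through q = (s / r) w, which is in the large polydisc. One bound M there gives 8 M (r / s)^2 for
  every w.\<close>

lemma holomorphic_fun_on_second_order:
  assumes f: "holomorphic_fun_on f V" and sub: "polydisc s \<subseteq> V" and s: "s > 0"
    and zero: "f 0 = 0" "(f has_derivative (\<lambda>_. 0)) (at 0)"
  obtains C where "C \<ge> 0"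
    "\<And>r w. 0 < r \<Longrightarrow> r \<le> s / 2 \<Longrightarrow> w \<in> polydisc r \<Longrightarrow> cmod (f w) \<le> C * r\<^sup>2"
proof -
  have "compact (f ` polydisc s)"
    using holomorphic_fun_on_continuous[OF f] sub
    by (intro compact_continuous_image compact_polydisc) (rule continuous_on_subset)
  then obtain M where M: "\<And>w. w \<in> polydisc s \<Longrightarrow> cmod (f w) \<le> M"
    using compact_imp_bounded[of "f ` polydisc s"] unfolding bounded_iff by auto
  have "M \<ge> 0" using M[of 0] zero s by (simp add: zero_in_polydisc)
  moreover have "cmod (f w) \<le> 8 * M / s\<^sup>2 * r\<^sup>2" if r: "0 < r" "r \<le> s / 2" and w: "w \<in> polydisc r" for r w
  proof -
    define q where "q = complex_of_real (s / r) *s w"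
    have q: "q \<in> polydisc s"
      using w r s by (auto simp: q_def polydisc_def norm_mult norm_divide field_simps)
    have hol: "(\<lambda>t. f (t *s q)) holomorphic_on cball 0 1"
      by (rule holomorphic_fun_on_radial[OF f sub q])
    have "((\<lambda>t. f (t *s q)) has_field_derivative 0) (at 0)"
      using has_field_derivative_along_line[of f "\<lambda>_. 0" 0 0 q] zero(2) by simp
    from second_order_bound_unit_disc[OF hol _ _ this, of M "complex_of_real (r / s)"]
    have "cmod (f (complex_of_real (r / s) *s q)) \<le> 8 * M * (cmod (complex_of_real (r / s)))\<^sup>2"
      using M polydisc_scale[OF q] zero r s by (simp add: norm_divide field_simps)
    moreover have "complex_of_real (r / s) *s q = w" using r s by (simp add: q_def vec_eq_iff)
    ultimately show ?thesis using r s by (simp add: power_divide norm_divide)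
  qed
  ultimately show ?thesis using s by (intro that[of "8 * M / s\<^sup>2"]) auto
qed

section \<open>Means over the distinguished boundary\<close>

abbreviation torus :: "real \<Rightarrow> (complex^'n) set" where
  "torus r \<equiv> {w. \<forall>\<alpha>. cmod (w $ \<alpha>) = r}"

definition torus_mean :: "real \<Rightarrow> (complex^'n \<Rightarrow> complex) \<Rightarrow> complex" where
  "torus_mean r F = (\<integral>w. F (boundary_point r w) \<partial>exterior r)"

lemma boundary_point_in_torus: "r > 0 \<Longrightarrow> boundary_point r w \<in> torus r"
  by (simp add: boundary_point_def)

lemma torus_subset_polydisc: "torus r \<subseteq> polydisc r"
  by (auto simp: polydisc_def)

lemma holomorphic_fun_on_continuous_torus:
  assumes "holomorphic_fun_on f V" "polydisc r \<subseteq> V"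
  shows "continuous_on (torus r) f"
  using holomorphic_fun_on_continuous[OF assms(1)] torus_subset_polydisc assms(2)
  by (rule continuous_on_subset[OF _ subset_trans])

lemma polydisc_contour_eq_torus_mean:
  fixes F :: "complex^'n \<Rightarrow> complex"
  assumes "r > 0" "continuous_on (torus r) F"
  shows "polydisc_contour r (\<lambda>w. F w / (\<Prod>\<alpha>\<in>UNIV. w $ \<alpha>)) / (2 * pi * \<i>) ^ CARD('n) = torus_mean r F"
  using boundary_integral(2)[OF assms] by (simp add: torus_mean_def)

lemma finite_measure_exterior:
  assumes "r > 0" shows "finite_measure (exterior r :: (complex^'n) measure)"
  using emeasure_exterior_space[OF assms, where 'n = 'n] by (intro finite_measureI) simp

lemma torus_bounded:
  fixes F :: "complex^'n \<Rightarrow> complex"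
  assumes "continuous_on (torus r) F"
  obtains B where "\<And>w. w \<in> torus r \<Longrightarrow> cmod (F w) \<le> B"
  using compact_imp_bounded[OF compact_continuous_image[OF assms compact_torus]]
  unfolding bounded_iff by auto

lemma integrable_boundary:
  fixes F :: "complex^'n \<Rightarrow> complex"
  assumes r: "r > 0" and F: "continuous_on (torus r) F"
  shows "integrable (exterior r) (\<lambda>w. F (boundary_point r w))"
proof -
  obtain B where "\<And>w. w \<in> torus r \<Longrightarrow> cmod (F w) \<le> B" using torus_bounded[OF F] by blast
  then show ?thesis
    using boundary_point_in_torus[OF r] boundary_integral(1)[OF r F]
    by (intro finite_measure.integrable_const_bound[OF finite_measure_exterior[OF r], of _ B]) auto
qed

lemma torus_mean_const: "r > 0 \<Longrightarrow> torus_mean r (\<lambda>w :: complex^'n. c) = c"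
  using emeasure_exterior_space[of r, where 'n = 'n] by (simp add: torus_mean_def measure_def)

lemma torus_mean_cong:
  assumes "r > 0" "\<And>w. w \<in> torus r \<Longrightarrow> F w = G w"
  shows "torus_mean r F = torus_mean r G"
  unfolding torus_mean_def
  by (intro Bochner_Integration.integral_cong refl assms(2) boundary_point_in_torus assms(1))

lemma torus_mean_add:
  assumes "r > 0" "continuous_on (torus r) F" "continuous_on (torus r) G"
  shows "torus_mean r (\<lambda>w. F w + G w) = torus_mean r F + torus_mean r G"
  unfolding torus_mean_def
  by (intro Bochner_Integration.integral_add integrable_boundary assms)

lemma torus_mean_cmult: "torus_mean r (\<lambda>w. c * F w) = c * torus_mean r F"
  unfolding torus_mean_def by simp

lemma torus_mean_cnj: "torus_mean r (\<lambda>w. cnj (F w)) = cnj (torus_mean r F)"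
  unfolding torus_mean_def by (rule Bochner_Integration.integral_cnj)

lemma torus_mean_sum:
  assumes "r > 0" "\<And>i. i \<in> I \<Longrightarrow> continuous_on (torus r) (F i)"
  shows "torus_mean r (\<lambda>w. \<Sum>i\<in>I. F i w) = (\<Sum>i\<in>I. torus_mean r (F i))"
  unfolding torus_mean_def
  by (intro Bochner_Integration.integral_sum integrable_boundary assms)

lemma cnj_mult_self: "cnj x * x = of_real ((cmod x)\<^sup>2)"
  by (metis complex_norm_square mult.commute)

lemma torus_mean_square_nonneg: "Re (torus_mean r (\<lambda>w. cnj (F w) * F w)) \<ge> 0"
  unfolding cnj_mult_self torus_mean_def integral_complex_of_real by simp

lemma torus_mean_square_le:
  assumes "r > 0" and F: "continuous_on (torus r) F" and B: "\<And>w. w \<in> torus r \<Longrightarrow> cmod (F w) \<le> B"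
  shows "cmod (torus_mean r (\<lambda>w :: complex^'n. cnj (F w) * F w)) \<le> B\<^sup>2"
proof -
  have *: "continuous_on (torus r) (\<lambda>w. cnj (F w) * F w)" using F by (intro continuous_intros)
  have "cmod (torus_mean r (\<lambda>w. cnj (F w) * F w))
      \<le> (\<integral>w. cmod (cnj (F (boundary_point r w)) * F (boundary_point r w)) \<partial>exterior r)"
    unfolding torus_mean_def by (rule integral_norm_bound)
  also have "\<dots> \<le> (\<integral>w. B\<^sup>2 \<partial>(exterior r :: (complex^'n) measure))"
  proof (rule integral_mono)
    show "integrable (exterior r) (\<lambda>w. cmod (cnj (F (boundary_point r w)) * F (boundary_point r w)))"
      using integrable_boundary[OF assms(1) *] by (rule integrable_norm)
    show "integrable (exterior r) (\<lambda>w :: complex^'n. B\<^sup>2)"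
      by (rule finite_measure.integrable_const[OF finite_measure_exterior[OF assms(1)]])
    show "cmod (cnj (F (boundary_point r w)) * F (boundary_point r w)) \<le> B\<^sup>2" for w
      using power_mono[OF B[OF boundary_point_in_torus[OF assms(1), of w]], of 2]
      by (simp add: norm_mult power2_eq_square)
  qed
  also have "\<dots> = B\<^sup>2"
    using emeasure_exterior_space[OF assms(1), where 'n = 'n] by (simp add: measure_def)
  finally show ?thesis .
qed

text \<open>\<open>polydisc_contour\<close> uses one unspecified order of the variables. Allowing
  any order makes it possible to put a chosen variable outermost.\<close>

lemma iterated_contour_eq_torus_mean:
  fixes F :: "complex^'n \<Rightarrow> complex"
  assumes r: "r > 0" and F: "continuous_on (torus r) F" and \<alpha>s: "distinct \<alpha>s" "set \<alpha>s = UNIV"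
  shows "iterated_contour r \<alpha>s (\<lambda>w. F w / (\<Prod>\<alpha>\<in>UNIV. w $ \<alpha>)) 0 = (2 * pi * \<i>) ^ CARD('n) * torus_mean r F"
proof -
  define K where "K \<theta> = F (\<chi> i. rcis r (\<theta> $ i))" for \<theta> :: "real^'n"
  have mem: "(\<chi> i. rcis r (\<theta> $ i)) \<in> torus r" for \<theta> :: "real^'n" using r by simp
  have contK: "continuous_on UNIV K"
    unfolding K_def
  proof (rule continuous_on_compose2[OF F])
    show "continuous_on UNIV (\<lambda>\<theta>::real^'n. \<chi> i. rcis r (\<theta> $ i))"
      unfolding rcis_def cis_conv_exp by (intro continuous_intros)
  qed (use mem in blast)
  obtain B where "\<And>w. w \<in> torus r \<Longrightarrow> cmod (F w) \<le> B" using torus_bounded[OF F] by blast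
  then have B: "norm (K \<theta>) \<le> B" for \<theta> unfolding K_def using mem by blast
  have "length \<alpha>s = CARD('n)" using distinct_card[OF \<alpha>s(1)] \<alpha>s(2) by simp
  have "iterated_contour r \<alpha>s (\<lambda>w. F w / (\<Prod>\<alpha>\<in>UNIV. w $ \<alpha>)) 0
      = iterated_contour r \<alpha>s (\<lambda>w. F w / (\<Prod>\<alpha>\<in>UNIV. w $ \<alpha>)) (\<chi> i. rcis r ((0::real^'n) $ i))"
    by (rule iterated_contour_cong) (simp add: \<alpha>s)
  also have "\<dots> = (2 * pi * \<i>) ^ CARD('n) *
      (\<integral>x. K (\<chi> i. Arg (x i)) \<partial>Pi\<^sub>M UNIV (\<lambda>_. exterior1 r))"
    using iterated_contour_eq_integral[OF r contK B _ \<alpha>s(1), of F 0] \<alpha>s \<open>length \<alpha>s = _\<close>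
    by (simp add: K_def)
  also have "(\<integral>x. K (\<chi> i. Arg (x i)) \<partial>Pi\<^sub>M UNIV (\<lambda>_. exterior1 r)) = torus_mean r F"
    unfolding torus_mean_def
    by (subst integral_exterior[OF boundary_integral(1)[OF r F]]) (simp add: K_def boundary_point_def)
  finally show ?thesis .
qed

text \<open>Each contour puts one more coordinate on the circle, so the integrand is only ever
  evaluated on the torus once the coordinates outside the list are there. For the full list the base
  point is unrestricted.\<close>

lemma iterated_contour_cong_torus:
  fixes F G :: "complex^'n \<Rightarrow> complex"
  assumes "r > 0" "\<And>w. w \<in> torus r \<Longrightarrow> F w = G w" "\<And>\<beta>. \<beta> \<notin> set \<alpha>s \<Longrightarrow> cmod (w $ \<beta>) = r"
  shows "iterated_contour r \<alpha>s F w = iterated_contour r \<alpha>s G w"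
  using assms(3)
proof (induction \<alpha>s arbitrary: w)
  case Nil
  then show ?case using assms(2) by simp
next
  case (Cons \<alpha> \<alpha>s)
  show ?case
    unfolding iterated_contour.simps
    by (intro contour_integral_eq Cons.IH) (use assms(1) Cons.prems in auto)
qed

lemma enumeration_UNIV:
  "distinct (SOME \<alpha>s :: 'n::finite list. distinct \<alpha>s \<and> set \<alpha>s = UNIV)"
  "set (SOME \<alpha>s :: 'n list. distinct \<alpha>s \<and> set \<alpha>s = UNIV) = UNIV"
proof -
  have "\<exists>\<alpha>s :: 'n list. distinct \<alpha>s \<and> set \<alpha>s = UNIV"
    using finite_distinct_list[of "UNIV :: 'n set"] by auto
  from someI_ex[OF this] show "distinct (SOME \<alpha>s :: 'n list. distinct \<alpha>s \<and> set \<alpha>s = UNIV)"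
    "set (SOME \<alpha>s :: 'n list. distinct \<alpha>s \<and> set \<alpha>s = UNIV) = UNIV" by auto
qed

lemma polydisc_contour_cong:
  assumes "r > 0" "\<And>w. w \<in> torus r \<Longrightarrow> F w = G w"
  shows "polydisc_contour r F = polydisc_contour r G"
  unfolding polydisc_contour_def
  by (rule iterated_contour_cong_torus) (use assms enumeration_UNIV(2) in auto)

text \<open>
  The factor \<open>m\<close> collects the reciprocals of the outer variables, which makes the induction
  over the variables go through.
\<close>
lemma iterated_contour_holomorphic:
  fixes f :: "complex^'n \<Rightarrow> complex"
  assumes r: "r > 0" and f: "holomorphic_fun_on f V" and sub: "polydisc r \<subseteq> V"
    and "distinct \<alpha>s" "w \<in> polydisc r"
    and "\<And>w w'. (\<And>\<beta>. \<beta> \<notin> set \<alpha>s \<Longrightarrow> w $ \<beta> = w' $ \<beta>) \<Longrightarrow> m w = m w'"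
  shows "iterated_contour r \<alpha>s (\<lambda>w. f w * m w / (\<Prod>\<alpha>\<in>set \<alpha>s. w $ \<alpha>)) w =
    (2 * pi * \<i>) ^ length \<alpha>s * f (\<chi> \<beta>. if \<beta> \<in> set \<alpha>s then 0 else w $ \<beta>) * m w"
  using assms(4-)
proof (induction \<alpha>s arbitrary: w m)
  case Nil
  show ?case by simp
next
  case (Cons \<alpha> \<alpha>s)
  have notin: "\<alpha> \<notin> set \<alpha>s" and dist: "distinct \<alpha>s" using Cons.prems(1) by auto
  define u where "u t = (\<chi> \<beta>. if \<beta> = \<alpha> then t else w $ \<beta>)" for t
  define p where "p = (\<chi> \<beta>. if \<beta> \<in> set (\<alpha> # \<alpha>s) then 0 else w $ \<beta>)"
  \<comment> \<open>The inner Cauchy formulas have already set their coordinates to 0, so what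
    remains is f on the line through \<open>p\<close> in direction \<alpha>.\<close>
  have p: "(\<chi> \<beta>. if \<beta> \<in> set \<alpha>s then 0 else u t $ \<beta>) = p + t *s axis \<alpha> 1" for t
    using notin by (auto simp: vec_eq_iff u_def p_def axis_def)
  have m_u: "m (u t) = m w" for t
    by (rule Cons.prems(3)) (auto simp: u_def)
  have hol: "(\<lambda>t. f (p + t *s axis \<alpha> 1)) holomorphic_on cball 0 r"
    by (rule holomorphic_on_subset[OF holomorphic_fun_on_line[OF f]])
      (use Cons.prems(2) sub r in \<open>auto simp: polydisc_def p_def axis_def subset_eq\<close>)
  have inner: "iterated_contour r \<alpha>s (\<lambda>w. f w * m w / (\<Prod>\<alpha>\<in>set (\<alpha> # \<alpha>s). w $ \<alpha>)) (u t)
      = (2 * pi * \<i>) ^ length \<alpha>s * m w * (f (p + t *s axis \<alpha> 1) / (t - 0))"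
    if "cmod t = r" for t
  proof -
    have "iterated_contour r \<alpha>s (\<lambda>w. f w * (m w / w $ \<alpha>) / (\<Prod>\<alpha>\<in>set \<alpha>s. w $ \<alpha>)) (u t)
      = (2 * pi * \<i>) ^ length \<alpha>s * f (\<chi> \<beta>. if \<beta> \<in> set \<alpha>s then 0 else u t $ \<beta>) * (m (u t) / u t $ \<alpha>)"
    proof (rule Cons.IH[OF dist])
      show "u t \<in> polydisc r" using Cons.prems(2) that by (auto simp: u_def polydisc_def)
      fix w w' :: "complex^'n" assume *: "\<And>\<beta>. \<beta> \<notin> set \<alpha>s \<Longrightarrow> w $ \<beta> = w' $ \<beta>"
      then have "m w = m w'" by (intro Cons.prems(3)) auto
      then show "m w / w $ \<alpha> = m w' / w' $ \<alpha>" using *[OF notin] by simp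
    qed
    then show ?thesis using notin unfolding p m_u by (simp add: u_def mult_ac)
  qed
  have "contour_integral (circlepath 0 r)
       (\<lambda>t. iterated_contour r \<alpha>s (\<lambda>w. f w * m w / (\<Prod>\<alpha>\<in>set (\<alpha> # \<alpha>s). w $ \<alpha>)) (u t))
     = contour_integral (circlepath 0 r)
       (\<lambda>t. (2 * pi * \<i>) ^ length \<alpha>s * m w * (f (p + t *s axis \<alpha> 1) / (t - 0)))"
    by (rule contour_integral_eq, rule inner) (use r in auto)
  also have "\<dots> = (2 * pi * \<i>) ^ length \<alpha>s * m w * (2 * pi * \<i> * f (p + 0 *s axis \<alpha> 1))"
    using Cauchy_integral_circlepath_simple[OF hol, of 0] r
    by (intro contour_integral_unique has_contour_integral_lmul) (simp add: mult_ac)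
  finally show ?case by (simp add: u_def p_def)
qed

text \<open>Each of the n Cauchy formulas sets its variable to 0 and contributes a factor 2 pi i,
  which the normalisation cancels.\<close>

lemma torus_mean_holomorphic:
  fixes f :: "complex^'n \<Rightarrow> complex"
  assumes r: "r > 0" and f: "holomorphic_fun_on f V" and sub: "polydisc r \<subseteq> V"
  shows "torus_mean r f = f 0"
proof -
  obtain \<alpha>s :: "'n list" where \<alpha>s: "distinct \<alpha>s" "set \<alpha>s = UNIV"
    using enumeration_UNIV by blast
  have len: "length \<alpha>s = CARD('n)" using distinct_card[OF \<alpha>s(1)] \<alpha>s(2) by simp
  have "continuous_on (torus r) f"
    by (rule holomorphic_fun_on_continuous_torus[OF f sub])
  from iterated_contour_eq_torus_mean[OF r this \<alpha>s]
  have "(2 * pi * \<i>) ^ CARD('n) * torus_mean r f = (2 * pi * \<i>) ^ CARD('n) * f (\<chi> \<beta>. 0)"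
    using iterated_contour_holomorphic[OF r f sub \<alpha>s(1) zero_in_polydisc, of "\<lambda>_. 1"] r \<alpha>s(2) len
    by simp
  moreover have "(\<chi> \<beta>. 0) = (0 :: complex^'n)" by (simp add: vec_eq_iff)
  ultimately show ?thesis by simp
qed

lemma cnj_nth_torus:
  assumes "r > 0" "w \<in> torus r"
  shows "cnj (w $ \<beta>) = of_real (r\<^sup>2) / w $ \<beta>"
proof -
  have "w $ \<beta> * cnj (w $ \<beta>) = of_real (r\<^sup>2)"
    using assms complex_norm_square[of "w $ \<beta>"] by simp
  moreover have "w $ \<beta> \<noteq> 0" using assms by auto
  ultimately show ?thesis by (simp add: field_simps)
qed

text \<open>On the torus cnj(w_\<beta>) is r^2 / w_\<beta>; together with the 1 / w_\<beta> of the
  measure this is a double pole, so Cauchy's formula yields a first derivative. The variable \<beta>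
  heads the list, hence is integrated last, after the simple Cauchy formula has set all others to
  0.\<close>

lemma torus_mean_holomorphic_cnj:
  fixes f :: "complex^'n \<Rightarrow> complex"
  assumes r: "r > 0" and f: "holomorphic_fun_on f V" and sub: "polydisc r \<subseteq> V"
    and f': "(f has_derivative f') (at 0)" "\<And>c v. f' (c *s v) = c * f' v"
  shows "torus_mean r (\<lambda>w. f w * cnj (w $ \<beta>)) = of_real (r\<^sup>2) * f' (axis \<beta> 1)"
proof -
  obtain \<alpha>s where "distinct \<alpha>s" "set \<alpha>s = UNIV - {\<beta>}"
    using finite_distinct_list[of "UNIV - {\<beta>}"] by auto
  then have \<alpha>s: "distinct (\<beta> # \<alpha>s)" "set (\<beta> # \<alpha>s) = UNIV" by auto
  have len: "length (\<beta> # \<alpha>s) = CARD('n)" using distinct_card[OF \<alpha>s(1)] \<alpha>s(2) by simp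
  have notin: "\<beta> \<notin> set \<alpha>s" and dist: "distinct \<alpha>s" using \<alpha>s(1) by auto
  define u where "u t = (\<chi> \<gamma>. if \<gamma> = \<beta> then t else (0 :: complex^'n) $ \<gamma>)" for t
  have u: "(\<chi> \<gamma>. if \<gamma> \<in> set \<alpha>s then 0 else u t $ \<gamma>) = 0 + t *s axis \<beta> 1" for t
    using notin by (auto simp: vec_eq_iff u_def axis_def)
  have contf: "continuous_on (torus r) f"
    by (rule holomorphic_fun_on_continuous_torus[OF f sub])
  have cont: "continuous_on (torus r) (\<lambda>w. f w / w $ \<beta>)"
    using r by (intro continuous_intros contf) auto
  have hol: "(\<lambda>t. f (0 + t *s axis \<beta> 1)) holomorphic_on cball 0 r"
    by (rule holomorphic_on_subset[OF holomorphic_fun_on_line[OF f]])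
      (use sub r in \<open>auto simp: polydisc_def axis_def subset_eq\<close>)
  have inner: "iterated_contour r \<alpha>s (\<lambda>w. f w / w $ \<beta> / (\<Prod>\<alpha>\<in>UNIV. w $ \<alpha>)) (u t)
      = (2 * pi * \<i>) ^ length \<alpha>s * (f (0 + t *s axis \<beta> 1) / (t - 0) ^ Suc 1)" if "cmod t = r" for t
  proof -
    \<comment> \<open>The outer factor is an inverse square: one power from the integrand, one from
      the full product. It is constant for the inner contours because \<beta> is not among
      them.\<close>
    have "iterated_contour r \<alpha>s (\<lambda>w. f w * (1 / (w $ \<beta>)\<^sup>2) / (\<Prod>\<alpha>\<in>set \<alpha>s. w $ \<alpha>)) (u t)
      = (2 * pi * \<i>) ^ length \<alpha>s * f (\<chi> \<gamma>. if \<gamma> \<in> set \<alpha>s then 0 else u t $ \<gamma>) * (1 / (u t $ \<beta>)\<^sup>2)"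
      by (rule iterated_contour_holomorphic[OF r f sub dist])
        (use that notin in \<open>auto simp: u_def polydisc_def\<close>)
    moreover have "(\<Prod>\<alpha>\<in>UNIV. w $ \<alpha>) = w $ \<beta> * (\<Prod>\<alpha>\<in>set \<alpha>s. w $ \<alpha>)" for w :: "complex^'n"
      using notin unfolding \<alpha>s(2)[symmetric] by simp
    ultimately show ?thesis unfolding u by (simp add: u_def power2_eq_square mult.assoc)
  qed
  have "(2 * pi * \<i>) ^ CARD('n) * torus_mean r (\<lambda>w. f w / w $ \<beta>)
      = iterated_contour r (\<beta> # \<alpha>s) (\<lambda>w. f w / w $ \<beta> / (\<Prod>\<alpha>\<in>UNIV. w $ \<alpha>)) 0"
    using iterated_contour_eq_torus_mean[OF r cont \<alpha>s] by simp
  also have "\<dots> = contour_integral (circlepath 0 r)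
      (\<lambda>t. (2 * pi * \<i>) ^ length \<alpha>s * (f (0 + t *s axis \<beta> 1) / (t - 0) ^ Suc 1))"
    unfolding iterated_contour.simps u_def[symmetric]
    by (rule contour_integral_eq, rule inner) (use r in auto)
  also have "\<dots> = (2 * pi * \<i>) ^ length \<alpha>s *
      (2 * pi * \<i> / fact 1 * (deriv ^^ 1) (\<lambda>t. f (0 + t *s axis \<beta> 1)) 0)"
    by (intro contour_integral_unique has_contour_integral_lmul
        Cauchy_has_contour_integral_higher_derivative_circlepath
        holomorphic_on_imp_continuous_on[OF hol] holomorphic_on_subset[OF hol]) (use r in auto)
  also have "(deriv ^^ 1) (\<lambda>t. f (0 + t *s axis \<beta> 1)) 0 = f' (axis \<beta> 1)"
    using DERIV_imp_deriv[OF has_field_derivative_along_line[of f f' 0 0 "axis \<beta> 1"]] f' by simp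
  finally have *: "torus_mean r (\<lambda>w. f w / w $ \<beta>) = f' (axis \<beta> 1)"
    by (simp add: len[symmetric])
  have "torus_mean r (\<lambda>w. f w * cnj (w $ \<beta>)) = torus_mean r (\<lambda>w. of_real (r\<^sup>2) * (f w / w $ \<beta>))"
    by (intro torus_mean_cong r) (simp add: cnj_nth_torus[OF r])
  then show ?thesis by (simp only: torus_mean_cmult *)
qed

section \<open>Mean squares\<close>

definition mean_square :: "real \<Rightarrow> (complex^'n \<Rightarrow> complex) \<Rightarrow> real" where
  "mean_square r F = Re (torus_mean r (\<lambda>w. cnj (F w) * F w))"

lemma mean_square_nonneg: "mean_square r F \<ge> 0"
  unfolding mean_square_def by (rule torus_mean_square_nonneg)

lemma mean_square_cong:
  assumes "r > 0" "\<And>w. w \<in> torus r \<Longrightarrow> F w = G w"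
  shows "mean_square r F = mean_square r G"
  unfolding mean_square_def using torus_mean_cong[OF assms(1)] assms(2) by (metis (mono_tags, lifting))

lemma mean_square_le:
  assumes "r > 0" "continuous_on (torus r) F" "\<And>w. w \<in> torus r \<Longrightarrow> cmod (F w) \<le> B"
  shows "mean_square r F \<le> B\<^sup>2"
  using torus_mean_square_le[OF assms] abs_Re_le_cmod unfolding mean_square_def
  by (meson abs_le_D1 order_trans)

lemma mean_square_cnj: "mean_square r (\<lambda>w. cnj (F w)) = mean_square r F"
  by (simp add: mean_square_def mult.commute)

text \<open>Pythagoras: the second cross term is the conjugate of the one assumed to vanish.\<close>

lemma mean_square_add_orthogonal:
  assumes r: "r > 0" and F: "continuous_on (torus r) F" and G: "continuous_on (torus r) G"
    and orth: "torus_mean r (\<lambda>w. G w * cnj (F w)) = 0"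
  shows "mean_square r (\<lambda>w. F w + G w) = mean_square r F + mean_square r G"
proof -
  have "torus_mean r (\<lambda>w. cnj (F w + G w) * (F w + G w))
      = torus_mean r (\<lambda>w. (cnj (F w) * F w + cnj (G w) * G w) + (G w * cnj (F w) + cnj (G w * cnj (F w))))"
    by (rule torus_mean_cong[OF r]) (simp add: algebra_simps)
  also have "\<dots> = torus_mean r (\<lambda>w. cnj (F w) * F w) + torus_mean r (\<lambda>w. cnj (G w) * G w)
      + (torus_mean r (\<lambda>w. G w * cnj (F w)) + torus_mean r (\<lambda>w. cnj (G w * cnj (F w))))"
    by (subst torus_mean_add[OF r], (intro continuous_intros F G)+)+ simp
  finally show ?thesis
    using orth torus_mean_cnj[of r "\<lambda>w. G w * cnj (F w)"] by (simp add: mean_square_def)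
qed

lemma mean_square_const: "r > 0 \<Longrightarrow> mean_square r (\<lambda>w :: complex^'n. c) = (cmod c)\<^sup>2"
  by (simp only: mean_square_def torus_mean_const cnj_mult_self Re_complex_of_real)

text \<open>Pairing with a linear form reads off the derivative at 0. Taking f to be the same form
  gives its mean square; a zero derivative gives orthogonality.\<close>

lemma torus_mean_cnj_linear:
  fixes f :: "complex^'n \<Rightarrow> complex"
  assumes r: "r > 0" and f: "holomorphic_fun_on f V" and sub: "polydisc r \<subseteq> V"
    and f': "(f has_derivative f') (at 0)" "\<And>c v. f' (c *s v) = c * f' v"
  shows "torus_mean r (\<lambda>w. f w * cnj (\<Sum>\<beta>\<in>UNIV. c \<beta> * w $ \<beta>))
    = of_real (r\<^sup>2) * (\<Sum>\<beta>\<in>UNIV. cnj (c \<beta>) * f' (axis \<beta> 1))"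
proof -
  have cont: "continuous_on (torus r) f" by (rule holomorphic_fun_on_continuous_torus[OF f sub])
  have "torus_mean r (\<lambda>w. f w * cnj (\<Sum>\<beta>\<in>UNIV. c \<beta> * w $ \<beta>))
      = torus_mean r (\<lambda>w. \<Sum>\<beta>\<in>UNIV. cnj (c \<beta>) * (f w * cnj (w $ \<beta>)))"
    by (rule torus_mean_cong[OF r]) (simp add: sum_distrib_left mult_ac)
  also have "\<dots> = (\<Sum>\<beta>\<in>UNIV. cnj (c \<beta>) * torus_mean r (\<lambda>w. f w * cnj (w $ \<beta>)))"
    by (subst torus_mean_sum[OF r]) (auto intro!: continuous_intros cont simp: torus_mean_cmult)
  finally show ?thesis
    by (simp add: torus_mean_holomorphic_cnj[OF r f sub f'] sum_distrib_left mult_ac)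
qed

lemma holomorphic_fun_on_linear: "holomorphic_fun_on (\<lambda>w. \<Sum>\<beta>\<in>UNIV. c \<beta> * w $ \<beta>) S"
  by (intro holomorphic_fun_on_sum holomorphic_fun_on_mult holomorphic_fun_on_const holomorphic_fun_on_nth)

lemma mean_square_linear:
  assumes r: "r > 0"
  shows "mean_square r (\<lambda>w :: complex^'n. \<Sum>\<beta>\<in>UNIV. c \<beta> * w $ \<beta>) = r\<^sup>2 * (\<Sum>\<beta>\<in>UNIV. (cmod (c \<beta>))\<^sup>2)"
proof -
  let ?L = "\<lambda>w :: complex^'n. \<Sum>\<beta>\<in>UNIV. c \<beta> * w $ \<beta>"
  have d: "(?L has_derivative ?L) (at 0)"
    by (intro has_derivative_sum has_derivative_mult_right bounded_linear_imp_has_derivative bounded_linear_vec_nth)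
  have "?L (axis \<beta> 1) = c \<beta>" for \<beta>
    by (simp add: axis_def if_distrib[of "(*) _"] cong: if_cong)
  then have *: "torus_mean r (\<lambda>w. ?L w * cnj (?L w)) = of_real (r\<^sup>2) * (\<Sum>\<beta>\<in>UNIV. cnj (c \<beta>) * c \<beta>)"
    using torus_mean_cnj_linear[OF r holomorphic_fun_on_linear subset_UNIV d, of c]
    by (simp add: sum_distrib_left mult_ac)
  have "torus_mean r (\<lambda>w. cnj (?L w) * ?L w) = torus_mean r (\<lambda>w. ?L w * cnj (?L w))"
    by (simp only: mult.commute)
  also have "\<dots> = of_real (r\<^sup>2 * (\<Sum>\<beta>\<in>UNIV. (cmod (c \<beta>))\<^sup>2))"
    unfolding * cnj_mult_self by simp
  finally show ?thesis unfolding mean_square_def by (simp only: Re_complex_of_real)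
qed

text \<open>The constant h(0) is orthogonal to h - h(0) because the latter has mean 0 by the mean
  value property.\<close>

lemma mean_square_holomorphic:
  assumes r: "r > 0" and h: "holomorphic_fun_on h V" and sub: "polydisc r \<subseteq> V"
  shows "mean_square r h = (cmod (h 0))\<^sup>2 + mean_square r (\<lambda>w. h w - h 0)"
proof -
  let ?k = "\<lambda>w. h w - h 0"
  have k: "holomorphic_fun_on ?k V" by (intro holomorphic_fun_on_diff h holomorphic_fun_on_const)
  have "torus_mean r (\<lambda>w. ?k w * cnj (h 0)) = 0"
    using torus_mean_holomorphic[OF r k sub] torus_mean_cmult[of r "cnj (h 0)" ?k] by (simp add: mult.commute)
  from mean_square_add_orthogonal[OF r continuous_on_const holomorphic_fun_on_continuous_torus[OF k sub] this]
  show ?thesis by (simp add: mean_square_const[OF r])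
qed

lemma mean_square_polar:
  fixes h :: "complex^'n \<Rightarrow> complex"
  assumes r: "r > 0" and h: "holomorphic_fun_on h V" and sub: "polydisc r \<subseteq> V"
  shows "mean_square r (\<lambda>w. (\<Sum>\<beta>\<in>UNIV. c \<beta> / w $ \<beta>) + h w) =
    (\<Sum>\<beta>\<in>UNIV. (cmod (c \<beta>))\<^sup>2) / r\<^sup>2 + (cmod (h 0))\<^sup>2 + mean_square r (\<lambda>w. h w - h 0)"
proof -
  \<comment> \<open>The polar part is the conjugate of this linear form on the torus. Pairing it
    with h therefore gives the mean of the holomorphic product h L, which is h(0) L(0) = 0.\<close>
  define L where "L w = (\<Sum>\<beta>\<in>UNIV. (cnj (c \<beta>) / of_real (r\<^sup>2)) * w $ \<beta>)" for w :: "complex^'n"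
  have polar: "(\<Sum>\<beta>\<in>UNIV. c \<beta> / w $ \<beta>) = cnj (L w)" if "w \<in> torus r" for w
    using r by (simp add: L_def cnj_nth_torus[OF r that])
  have L: "holomorphic_fun_on L V" unfolding L_def by (rule holomorphic_fun_on_linear)
  have "torus_mean r (\<lambda>w. h w * cnj (cnj (L w))) = 0"
    using torus_mean_holomorphic[OF r holomorphic_fun_on_mult[OF h L] sub] by (simp add: L_def)
  from mean_square_add_orthogonal[OF r _ holomorphic_fun_on_continuous_torus[OF h sub] this]
  have "mean_square r (\<lambda>w. cnj (L w) + h w) = mean_square r L + mean_square r h"
    using holomorphic_fun_on_continuous_torus[OF L sub]
    by (simp add: continuous_on_cnj mean_square_cnj)
  \<comment> \<open>The coefficients contribute 1 / r^4 and the mean square of a linear form r^2,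
    leaving 1 / r^2.\<close>
  moreover have "mean_square r L = (\<Sum>\<beta>\<in>UNIV. (cmod (c \<beta>))\<^sup>2) / r\<^sup>2"
    unfolding L_def mean_square_linear[OF r] using r
    by (simp add: norm_divide norm_power power_divide sum_divide_distrib[symmetric])
      (simp add: field_simps eval_nat_numeral)
  ultimately show ?thesis
    using mean_square_cong[OF r, of "\<lambda>w. (\<Sum>\<beta>\<in>UNIV. c \<beta> / w $ \<beta>) + h w" "\<lambda>w. cnj (L w) + h w"] polar
      mean_square_holomorphic[OF r h sub] by simp
qed

text \<open>The cross term is a combination of first partial derivatives of g at 0, all of which
  vanish.\<close>

lemma mean_square_second_order:
  fixes g :: "complex^'n \<Rightarrow> complex"
  assumes r: "r > 0" and g: "holomorphic_fun_on g V" and sub: "polydisc r \<subseteq> V"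
    and d: "(g has_derivative (\<lambda>_. 0)) (at 0)"
  shows "mean_square r (\<lambda>w. (\<Sum>\<beta>\<in>UNIV. c \<beta> * w $ \<beta>) + g w) =
    r\<^sup>2 * (\<Sum>\<beta>\<in>UNIV. (cmod (c \<beta>))\<^sup>2) + mean_square r g"
  using mean_square_add_orthogonal[OF r
      holomorphic_fun_on_continuous_torus[OF holomorphic_fun_on_linear sub]
      holomorphic_fun_on_continuous_torus[OF g sub], of c]
    torus_mean_cnj_linear[OF r g sub d, of c] mean_square_linear[OF r, of c] by simp

section \<open>The variance in a chart\<close>

lemma trace_sq_eq_sum: "trace_sq A = (\<Sum>a\<in>UNIV. \<Sum>\<beta>\<in>UNIV. (cmod (A $ a $ \<beta>))\<^sup>2)"
  unfolding trace_sq_def trace_def adjoint_matrix_def matrix_matrix_mult_def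
  by (subst sum.swap) (simp add: cnj_mult_self)

lemma trace_sq_nonneg: "trace_sq A \<ge> 0"
  unfolding trace_sq_eq_sum by (intro sum_nonneg) simp

lemma trace_sq_pos:
  assumes "A \<noteq> 0" shows "trace_sq A > 0"
proof -
  have "trace_sq A \<noteq> 0"
  proof
    assume "trace_sq A = 0"
    then have "A $ a $ \<beta> = 0" for a \<beta>
      unfolding trace_sq_eq_sum by (simp add: sum_nonneg_eq_0_iff sum_nonneg)
    then show False using assms by (simp add: vec_eq_iff)
  qed
  then show ?thesis using trace_sq_nonneg[of A] by simp
qed

lemma power2_norm_vec: "(norm (x :: complex^'k))\<^sup>2 = (\<Sum>a\<in>UNIV. (cmod (x $ a))\<^sup>2)"
  by (simp add: norm_vec_def L2_set_def sum_nonneg)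

text \<open>This makes the limit in \<open>analytic_part\<close> unique. On the path w + t (1, ...,
  1) with t > 0 small, zero coordinates of w become t and nonzero ones stay nonzero.\<close>

lemma at_within_off_axes_nontrivial: "at (w :: complex^'n) within off_axes \<noteq> bot"
proof -
  define c where "c t = w + (\<chi> \<beta>. of_real t)" for t :: real
  have "c \<midarrow>0\<rightarrow> w + (\<chi> \<beta>. of_real 0)"
    unfolding c_def by (intro tendsto_intros)
  moreover have "w + (\<chi> \<beta>. of_real 0) = w" by (simp add: vec_eq_iff)
  ultimately have lim: "(c \<longlongrightarrow> w) (at_right 0)"
    by (simp add: filterlim_at_split)
  have "\<forall>\<^sub>F t in at_right 0. c t $ \<beta> \<noteq> 0" for \<beta>
  proof (cases "w $ \<beta> = 0")
    case True
    then show ?thesis by (auto simp: c_def eventually_at_filter)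
  next
    case False
    then show ?thesis using tendsto_imp_eventually_ne[OF tendsto_vec_nth[OF lim]] by blast
  qed
  then have "\<forall>\<^sub>F t in at_right 0. c t \<in> off_axes"
    by (simp add: off_axes_def eventually_all_finite)
  moreover have "\<forall>\<^sub>F t in at_right 0. c t \<noteq> w"
    by (auto simp: c_def eventually_at_filter vec_eq_iff)
  ultimately have "filterlim c (at w within off_axes) (at_right 0)"
    using lim by (simp add: filterlim_at eventually_conj)
  then show ?thesis
    by (auto simp: filterlim_def filtermap_bot_iff bot_unique)
qed

text \<open>Fixing the pole data \<eta> and h allows the same formulas to be used twice: for \<psi>,
  and for its first-order part with the same \<eta> and an affine h.\<close>

locale polar_chart =
  fixes U :: "'m set" and z :: "'m \<Rightarrow> complex^'n" and \<psi> :: "'m \<Rightarrow> complex^'k"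
    and \<eta> :: "complex^'n^'k" and h :: "complex^'n \<Rightarrow> complex^'k"
  assumes open_image: "open (z ` U)"
    and holomorphic: "holomorphic_map_on h (z ` U)"
    and polar: "\<And>w. w \<in> z ` U \<Longrightarrow> w \<in> off_axes \<Longrightarrow> coord_rep U z \<psi> w = principal \<eta> w + h w"
begin

lemma component: "holomorphic_fun_on (\<lambda>w. h w $ a) (z ` U)"
  by (rule holomorphic_map_on_component[OF holomorphic])

section \<open>Core, residues, variance and Jacobian at a single scale\<close>

context
  fixes r :: real
  assumes scale: "r \<in> scales U z"
begin

lemma scale_pos: "r > 0" and sub: "polydisc r \<subseteq> z ` U"
  using scale by (auto simp: scales_def)

lemma coord_rep_torus:
  assumes "w \<in> torus r"
  shows "coord_rep U z \<psi> w $ a = (\<Sum>\<beta>\<in>UNIV. \<eta> $ a $ \<beta> / w $ \<beta>) + h w $ a"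
proof -
  have "w \<in> z ` U" using assms torus_subset_polydisc sub by blast
  moreover have "w \<in> off_axes" using assms scale_pos by (auto simp: off_axes_def)
  ultimately show ?thesis by (simp add: polar principal_def)
qed

lemma continuous_component: "continuous_on (torus r) (\<lambda>w. h w $ a)"
  by (rule holomorphic_fun_on_continuous_torus[OF component sub])

lemma continuous_over_nth:
  assumes "continuous_on (torus r) f"
  shows "continuous_on (torus r) (\<lambda>w :: complex^'n. f w / w $ \<beta>)"
  using scale_pos by (intro continuous_intros assms) auto

lemma continuous_polar: "continuous_on (torus r) (\<lambda>w. (\<Sum>\<beta>\<in>UNIV. \<eta> $ a $ \<beta> / w $ \<beta>) + h w $ a)"
  by (intro continuous_on_add continuous_on_sum continuous_over_nth continuous_on_const continuous_component)

lemma continuous_coord_rep: "continuous_on (torus r) (\<lambda>w. coord_rep U z \<psi> w $ a)"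
  by (rule continuous_on_eq[OF continuous_polar]) (simp add: coord_rep_torus)

lemma torus_mean_nth_over_nth:
  "torus_mean r (\<lambda>w :: complex^'n. w $ \<beta> / w $ \<gamma>) = (if \<gamma> = \<beta> then 1 else 0)"
proof -
  have "torus_mean r (\<lambda>w :: complex^'n. w $ \<beta> / w $ \<gamma>)
      = torus_mean r (\<lambda>w. (1 / of_real (r\<^sup>2)) * (w $ \<beta> * cnj (w $ \<gamma>)))"
    using scale_pos by (intro torus_mean_cong) (simp_all add: cnj_nth_torus)
  also have "\<dots> = (1 / of_real (r\<^sup>2)) * (of_real (r\<^sup>2) * axis \<gamma> 1 $ \<beta>)"
    unfolding torus_mean_cmult
    by (subst torus_mean_holomorphic_cnj[OF scale_pos holomorphic_fun_on_nth subset_UNIV, where f' = "\<lambda>v. v $ \<beta>"])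
      (auto intro: bounded_linear_imp_has_derivative bounded_linear_vec_nth)
  finally show ?thesis using scale_pos by (simp add: axis_def)
qed

lemma torus_mean_one_over_nth: "torus_mean r (\<lambda>w :: complex^'n. 1 / w $ \<gamma>) = 0"
proof -
  have "torus_mean r (\<lambda>w :: complex^'n. 1 / w $ \<gamma>)
      = torus_mean r (\<lambda>w. (1 / of_real (r\<^sup>2)) * cnj (w $ \<gamma>))"
    using scale_pos by (intro torus_mean_cong) (simp_all add: cnj_nth_torus)
  also have "\<dots> = 0"
    unfolding torus_mean_cmult torus_mean_cnj
    by (subst torus_mean_holomorphic[OF scale_pos holomorphic_fun_on_nth subset_UNIV]) simp
  finally show ?thesis .
qed

lemma core_eq: "core U z \<psi> r = h 0"
proof -
  have "core U z \<psi> r $ a = h 0 $ a" for a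
  proof -
    have "core U z \<psi> r $ a = torus_mean r (\<lambda>w. coord_rep U z \<psi> w $ a)"
      unfolding core_def using polydisc_contour_eq_torus_mean[OF scale_pos continuous_coord_rep, of a] by simp
    also have "\<dots> = torus_mean r (\<lambda>w. (\<Sum>\<beta>\<in>UNIV. \<eta> $ a $ \<beta> * (1 / w $ \<beta>)) + h w $ a)"
      by (rule torus_mean_cong[OF scale_pos]) (simp add: coord_rep_torus)
    also have "\<dots> = (\<Sum>\<beta>\<in>UNIV. \<eta> $ a $ \<beta> * torus_mean r (\<lambda>w. 1 / w $ \<beta>)) + torus_mean r (\<lambda>w. h w $ a)"
    proof (subst torus_mean_add[OF scale_pos])
      have *: "continuous_on (torus r) (\<lambda>w. \<eta> $ a $ \<beta> * (1 / w $ \<beta>))" for \<beta>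
        by (intro continuous_on_mult continuous_over_nth continuous_on_const)
      then show "continuous_on (torus r) (\<lambda>w. \<Sum>\<beta>\<in>UNIV. \<eta> $ a $ \<beta> * (1 / w $ \<beta>))"
        by (rule continuous_on_sum)
      show "torus_mean r (\<lambda>w. \<Sum>\<beta>\<in>UNIV. \<eta> $ a $ \<beta> * (1 / w $ \<beta>)) + torus_mean r (\<lambda>w. h w $ a)
          = (\<Sum>\<beta>\<in>UNIV. \<eta> $ a $ \<beta> * torus_mean r (\<lambda>w. 1 / w $ \<beta>)) + torus_mean r (\<lambda>w. h w $ a)"
        by (simp only: torus_mean_sum[OF scale_pos *] torus_mean_cmult)
    qed (rule continuous_component)
    also have "\<dots> = h 0 $ a"
      using torus_mean_holomorphic[OF scale_pos component sub] torus_mean_one_over_nth by simp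
    finally show ?thesis .
  qed
  then show ?thesis by (simp add: vec_eq_iff)
qed

lemma expectation_eq: "expectation U z \<psi> r = h 0"
  using core_eq by (simp add: expectation_def core_def)

text \<open>Restoring the omitted factor w_\<beta> turns the contour into the mean of \<psi>
  w_\<beta>. Only the term w_\<beta> / w_\<beta> survives, since h w_\<beta> vanishes at the
  centre.\<close>

lemma residue_matrix_eq: "residue_matrix U z \<psi> r = \<eta>"
proof -
  have "residue_matrix U z \<psi> r $ a $ \<beta> = \<eta> $ a $ \<beta>" for a \<beta>
  proof -
    have h\<beta>: "holomorphic_fun_on (\<lambda>w. h w $ a * w $ \<beta>) (z ` U)"
      by (intro holomorphic_fun_on_mult component holomorphic_fun_on_nth)
    have prod: "c / (\<Prod>\<mu>\<in>UNIV - {\<beta>}. w $ \<mu>) = c * w $ \<beta> / (\<Prod>\<mu>\<in>UNIV. w $ \<mu>)"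
      if "w \<in> torus r" for c and w :: "complex^'n"
      using that scale_pos by (subst prod.remove[of UNIV \<beta>]) auto
    have "residue_matrix U z \<psi> r $ a $ \<beta>
        = polydisc_contour r (\<lambda>w. (coord_rep U z \<psi> w $ a * w $ \<beta>) / (\<Prod>\<mu>\<in>UNIV. w $ \<mu>)) / (2 * pi * \<i>) ^ CARD('n)"
      unfolding residue_matrix_def vec_lambda_beta
      by (intro arg_cong2[where f = "(/)"] refl polydisc_contour_cong[OF scale_pos] prod)
    also have "\<dots> = torus_mean r (\<lambda>w. coord_rep U z \<psi> w $ a * w $ \<beta>)"
      by (intro polydisc_contour_eq_torus_mean scale_pos continuous_intros continuous_coord_rep)
    also have "\<dots> = torus_mean r (\<lambda>w. (\<Sum>\<gamma>\<in>UNIV. \<eta> $ a $ \<gamma> * (w $ \<beta> / w $ \<gamma>)) + h w $ a * w $ \<beta>)"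
      by (rule torus_mean_cong[OF scale_pos])
        (simp add: coord_rep_torus algebra_simps sum_distrib_left)
    also have "\<dots> = (\<Sum>\<gamma>\<in>UNIV. \<eta> $ a $ \<gamma> * torus_mean r (\<lambda>w. w $ \<beta> / w $ \<gamma>)) + torus_mean r (\<lambda>w. h w $ a * w $ \<beta>)"
    proof (subst torus_mean_add[OF scale_pos])
      have *: "continuous_on (torus r) (\<lambda>w. \<eta> $ a $ \<gamma> * (w $ \<beta> / w $ \<gamma>))" for \<gamma>
        by (intro continuous_on_mult continuous_over_nth continuous_intros)
      then show "continuous_on (torus r) (\<lambda>w. \<Sum>\<gamma>\<in>UNIV. \<eta> $ a $ \<gamma> * (w $ \<beta> / w $ \<gamma>))"
        by (rule continuous_on_sum)
      show "torus_mean r (\<lambda>w. \<Sum>\<gamma>\<in>UNIV. \<eta> $ a $ \<gamma> * (w $ \<beta> / w $ \<gamma>)) + torus_mean r (\<lambda>w. h w $ a * w $ \<beta>)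
          = (\<Sum>\<gamma>\<in>UNIV. \<eta> $ a $ \<gamma> * torus_mean r (\<lambda>w. w $ \<beta> / w $ \<gamma>)) + torus_mean r (\<lambda>w. h w $ a * w $ \<beta>)"
        by (simp only: torus_mean_sum[OF scale_pos *] torus_mean_cmult)
    qed (rule holomorphic_fun_on_continuous_torus[OF h\<beta> sub])
    also have "\<dots> = \<eta> $ a $ \<beta>"
      using torus_mean_holomorphic[OF scale_pos h\<beta> sub]
      by (simp add: torus_mean_nth_over_nth if_distrib[of "(*) _"] cong: if_cong)
    finally show ?thesis .
  qed
  then show ?thesis by (simp add: vec_eq_iff)
qed

text \<open>The contribution of h(0) to the mean square is exactly the squared norm of the
  expectation, so it cancels.\<close>

lemma lens_variance_eq:
  "lens_variance U z \<psi> r = trace_sq \<eta> / r\<^sup>2 + (\<Sum>a\<in>UNIV. mean_square r (\<lambda>w. h w $ a - h 0 $ a))"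
proof -
  let ?c = "\<lambda>w a. coord_rep U z \<psi> w $ a"
  have "lens_inner U z \<psi> \<psi> r = torus_mean r (\<lambda>w. \<Sum>a\<in>UNIV. cnj (?c w a) * ?c w a)"
    unfolding lens_inner_def
    by (intro polydisc_contour_eq_torus_mean scale_pos continuous_intros continuous_coord_rep)
  also have "\<dots> = (\<Sum>a\<in>UNIV. torus_mean r (\<lambda>w. cnj (?c w a) * ?c w a))"
    by (intro torus_mean_sum scale_pos continuous_intros continuous_coord_rep)
  finally have "Re (lens_inner U z \<psi> \<psi> r) = (\<Sum>a\<in>UNIV. mean_square r (\<lambda>w. ?c w a))"
    by (simp add: mean_square_def)
  also have "\<dots> = (\<Sum>a\<in>UNIV. mean_square r (\<lambda>w. (\<Sum>\<beta>\<in>UNIV. \<eta> $ a $ \<beta> / w $ \<beta>) + h w $ a))"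
    by (intro sum.cong refl mean_square_cong scale_pos coord_rep_torus)
  also have "\<dots> = (\<Sum>a\<in>UNIV. (\<Sum>\<beta>\<in>UNIV. (cmod (\<eta> $ a $ \<beta>))\<^sup>2) / r\<^sup>2 + (cmod (h 0 $ a))\<^sup>2
      + mean_square r (\<lambda>w. h w $ a - h 0 $ a))"
    by (simp only: mean_square_polar[OF scale_pos component sub])
  finally show ?thesis
    unfolding lens_variance_def expectation_eq power2_norm_vec trace_sq_eq_sum
    by (simp add: sum.distrib sum_divide_distrib)
qed

lemma analytic_part_eq:
  assumes "w \<in> z ` U"
  shows "analytic_part U z \<psi> r w = h w - h 0"
  unfolding analytic_part_def core_eq residue_matrix_eq
proof (rule tendsto_Lim[OF at_within_off_axes_nontrivial])
  have "isCont h w"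
    using holomorphic_map_on_continuous[OF holomorphic] continuous_on_eq_continuous_at[OF open_image] assms
    by blast
  then have "((\<lambda>v. h v - h 0) \<longlongrightarrow> h w - h 0) (at w within off_axes)"
    by (intro tendsto_intros) (auto simp: isCont_def intro: tendsto_within_subset)
  moreover have "\<forall>\<^sub>F v in at w within off_axes. v \<in> z ` U"
    using open_image assms by (meson eventually_at_topological)
  then have "\<forall>\<^sub>F v in at w within off_axes. h v - h 0 = coord_rep U z \<psi> v - h 0 - principal \<eta> v"
    unfolding eventually_at_filter by eventually_elim (auto simp: polar)
  ultimately show "((\<lambda>v. coord_rep U z \<psi> v - h 0 - principal \<eta> v) \<longlongrightarrow> h w - h 0) (at w within off_axes)"
    by (rule Lim_transform_eventually)
qed

text \<open>The matrix is defined by derivatives along the axes only. Complex-linearity determines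
  the Frechet derivative from its values on the axis vectors, so the two agree; in particular the
  matrix is the same at every scale.\<close>

lemma jacobian_matrix_derivative: "(h has_derivative (\<lambda>v. jacobian_matrix U z \<psi> r *v v)) (at 0)"
proof -
  have zero: "0 \<in> z ` U" using sub scale_pos zero_in_polydisc[of r] by auto
  then obtain h' where h': "(h has_derivative h') (at 0)" "\<And>c v. h' (c *s v) = c *s h' v"
    using holomorphic unfolding holomorphic_map_on_def by blast
  have jac: "jacobian_matrix U z \<psi> r $ a $ \<beta> = h' (axis \<beta> 1) $ a" for a \<beta>
  proof -
    have ax: "t *s axis \<beta> 1 = axis \<beta> t" for t :: complex by (simp add: vec_eq_iff axis_def)
    have "((\<lambda>w. h w $ a) has_derivative (\<lambda>v. h' v $ a)) (at 0)"
      using h'(1) by (rule bounded_linear.has_derivative[OF bounded_linear_vec_nth])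
    then have "((\<lambda>t. h (0 + t *s axis \<beta> 1) $ a) has_field_derivative h' (axis \<beta> 1) $ a) (at 0)"
      using has_field_derivative_along_line[of "\<lambda>w. h w $ a" "\<lambda>v. h' v $ a" 0 0 "axis \<beta> 1"] h'(2) by simp
    then have "((\<lambda>t. h (0 + t *s axis \<beta> 1) $ a - h 0 $ a) has_field_derivative h' (axis \<beta> 1) $ a) (at 0)"
      by (auto intro!: derivative_eq_intros)
    \<comment> \<open>\<open>analytic_part\<close> is known only on the image of the chart, so the
      two functions are compared near t = 0 before differentiating.\<close>
    moreover have "\<forall>\<^sub>F t in nhds 0. h (0 + t *s axis \<beta> 1) $ a - h 0 $ a = analytic_part U z \<psi> r (axis \<beta> t) $ a"
    proof -
      have "\<forall>\<^sub>F t in nhds 0. 0 + t *s axis \<beta> 1 \<in> z ` U"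
        using eventually_nhds_in_open[OF open_line_vimage[OF open_image], of 0 0 "axis \<beta> 1"] zero by simp
      then show ?thesis by eventually_elim (simp add: ax analytic_part_eq)
    qed
    ultimately have "((\<lambda>t. analytic_part U z \<psi> r (axis \<beta> t) $ a) has_field_derivative h' (axis \<beta> 1) $ a) (at 0)"
      by (rule DERIV_cong_ev[OF refl _ refl, THEN iffD1, rotated])
    then show ?thesis unfolding jacobian_matrix_def by (simp add: DERIV_imp_deriv)
  qed
  interpret h': bounded_linear h' using h'(1) by (rule has_derivative_bounded_linear)
  have "h' v = jacobian_matrix U z \<psi> r *v v" for v
  proof -
    have "h' v = h' (\<Sum>\<beta>\<in>UNIV. v $ \<beta> *s axis \<beta> 1)" by (simp only: basis_expansion)
    then show ?thesis
      by (simp add: h'.sum h'(2) vec_eq_iff matrix_vector_mult_def jac mult.commute)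
  qed
  then have "h' = (\<lambda>v. jacobian_matrix U z \<psi> r *v v)" by blast
  then show ?thesis using h'(1) by simp
qed

end

section \<open>The variance and its first-order part\<close>

text \<open>Equals \<open>higher_part\<close> on \<open>z ` U\<close>, without the limit in \<open>analytic_part\<close>.\<close>
definition remainder :: "real \<Rightarrow> complex^'n \<Rightarrow> complex^'k" where
  "remainder s w = h w - h 0 - jacobian_matrix U z \<psi> s *v w"

lemma remainder_nth:
  "remainder s w $ a = h w $ a - h 0 $ a - (\<Sum>\<beta>\<in>UNIV. jacobian_matrix U z \<psi> s $ a $ \<beta> * w $ \<beta>)"
  by (simp add: remainder_def matrix_vector_mult_def)

lemma remainder_zero: "remainder s 0 = 0"
  by (simp add: remainder_def)

lemma remainder_holomorphic: "holomorphic_fun_on (\<lambda>w. remainder s w $ a) (z ` U)"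
  unfolding remainder_nth
  by (intro holomorphic_fun_on_diff component holomorphic_fun_on_const holomorphic_fun_on_linear)

lemma remainder_derivative:
  assumes "s \<in> scales U z"
  shows "((\<lambda>w. remainder s w $ a) has_derivative (\<lambda>_. 0)) (at 0)"
proof -
  let ?D = "\<lambda>v. jacobian_matrix U z \<psi> s *v v"
  note d = jacobian_matrix_derivative[OF assms]
  have "(?D has_derivative ?D) (at 0)"
    using has_derivative_bounded_linear[OF d] by (rule bounded_linear_imp_has_derivative)
  then have "(remainder s has_derivative (\<lambda>v. ?D v - 0 - ?D v)) (at 0)"
    unfolding remainder_def by (intro has_derivative_diff d has_derivative_const)
  from bounded_linear.has_derivative[OF bounded_linear_vec_nth this] show ?thesis by simp
qed

text \<open>The scale s at which the Jacobian is read off is kept apart from the scale r of the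
  variance, so that r can vary with the coefficients fixed.\<close>

lemma lens_variance_split:
  assumes s: "s \<in> scales U z" and r: "r \<in> scales U z"
  shows "lens_variance U z \<psi> r = trace_sq \<eta> / r\<^sup>2 + r\<^sup>2 * trace_sq (jacobian_matrix U z \<psi> s)
    + (\<Sum>a\<in>UNIV. mean_square r (\<lambda>w. remainder s w $ a))"
proof -
  let ?D = "jacobian_matrix U z \<psi> s"
  have "mean_square r (\<lambda>w. h w $ a - h 0 $ a)
      = r\<^sup>2 * (\<Sum>\<beta>\<in>UNIV. (cmod (?D $ a $ \<beta>))\<^sup>2) + mean_square r (\<lambda>w. remainder s w $ a)" for a
    using mean_square_second_order[OF scale_pos[OF r] remainder_holomorphic sub[OF r] remainder_derivative[OF s],
        of "\<lambda>\<beta>. ?D $ a $ \<beta>" a]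
    by (simp add: remainder_nth)
  then show ?thesis
    by (simp add: lens_variance_eq[OF r] trace_sq_eq_sum sum.distrib sum_distrib_left)
qed

lemma power2_std_error:
  assumes "r \<in> scales U z"
  shows "(std_error U z \<psi> r)\<^sup>2 = lens_variance U z \<psi> r"
proof -
  have "lens_variance U z \<psi> r \<ge> 0"
    unfolding lens_variance_eq[OF assms]
    by (intro add_nonneg_nonneg divide_nonneg_nonneg trace_sq_nonneg sum_nonneg mean_square_nonneg) simp
  then show ?thesis by (simp add: std_error_def)
qed

lemma lens_variance_first_order_part:
  assumes s: "s \<in> scales U z" and r: "r \<in> scales U z"
  shows "lens_variance U z (first_order_part U z \<psi> s) r
    = trace_sq \<eta> / r\<^sup>2 + r\<^sup>2 * trace_sq (jacobian_matrix U z \<psi> s)"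
proof -
  let ?D = "jacobian_matrix U z \<psi> s"
  have lin: "bounded_linear (\<lambda>v. ?D *v v)"
    using jacobian_matrix_derivative[OF s] by (rule has_derivative_bounded_linear)
  \<comment> \<open>The first-order part has the same polar part and the affine holomorphic part
    h(0) + D w, so the variance formula applies to it with no remainder.\<close>
  interpret F: polar_chart U z "first_order_part U z \<psi> s" \<eta> "\<lambda>w. h 0 + ?D *v w"
  proof
    show "open (z ` U)" by (rule open_image)
    show "holomorphic_map_on (\<lambda>w. h 0 + ?D *v w) (z ` U)"
      unfolding holomorphic_map_on_def
    proof
      fix w
      have "((\<lambda>w. h 0 + ?D *v w) has_derivative (\<lambda>v. 0 + ?D *v v)) (at w)"
        by (intro has_derivative_add has_derivative_const bounded_linear_imp_has_derivative lin)
      then show "\<exists>f'. ((\<lambda>w. h 0 + ?D *v w) has_derivative f') (at w) \<and> (\<forall>c v. f' (c *s v) = c *s f' v)"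
        by (intro exI[of _ "\<lambda>v. ?D *v v"]) (simp add: vector_scalar_commute)
    qed
    fix w assume "w \<in> z ` U"
    then show "coord_rep U z (first_order_part U z \<psi> s) w = principal \<eta> w + (h 0 + ?D *v w)"
      by (simp add: coord_rep_def first_order_part_def f_inv_into_f core_eq[OF s] residue_matrix_eq[OF s])
  qed
  have "mean_square r (\<lambda>w. (h 0 + ?D *v w) $ a - (h 0 + ?D *v 0) $ a)
      = r\<^sup>2 * (\<Sum>\<beta>\<in>UNIV. (cmod (?D $ a $ \<beta>))\<^sup>2)" for a
    using mean_square_linear[OF scale_pos[OF r], of "\<lambda>\<beta>. ?D $ a $ \<beta>"]
    by (simp add: matrix_vector_mult_def)
  then show ?thesis
    by (simp only: F.lens_variance_eq[OF r] trace_sq_eq_sum sum_distrib_left)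
qed

lemma std_error_lower_bound:
  assumes r: "r \<in> scales U z"
  shows "r * std_error U z \<psi> r \<ge> sqrt (trace_sq (residue_matrix U z \<psi> r))"
proof -
  note pos = scale_pos[OF r]
  have "trace_sq \<eta> / r\<^sup>2 \<le> lens_variance U z \<psi> r"
    unfolding lens_variance_eq[OF r] by (simp add: sum_nonneg mean_square_nonneg)
  then have "sqrt (trace_sq \<eta> / r\<^sup>2) \<le> std_error U z \<psi> r"
    unfolding std_error_def by (rule real_sqrt_le_mono)
  then show ?thesis
    using pos by (simp add: residue_matrix_eq[OF r] real_sqrt_divide field_simps)
qed

lemma scales_downward: "s \<in> scales U z \<Longrightarrow> 0 < r \<Longrightarrow> r \<le> s \<Longrightarrow> r \<in> scales U z"
  using polydisc_mono[of r s] by (auto simp: scales_def)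

text \<open>The difference is the sum of the mean squares of the components of the remainder. Each
  component is at most C r^2 on the polydisc of radius r \<le> s / 2, and squaring gives the fourth
  power.\<close>

lemma variance_difference_bigo:
  assumes s: "s \<in> scales U z"
  shows "(\<lambda>r. (std_error U z \<psi> r)\<^sup>2 - (std_error U z (first_order_part U z \<psi> s) r)\<^sup>2)
    \<in> O[at_right 0](\<lambda>r. r ^ 4)"
proof -
  have "\<exists>C\<ge>0. \<forall>r w. 0 < r \<longrightarrow> r \<le> s / 2 \<longrightarrow> w \<in> polydisc r \<longrightarrow> cmod (remainder s w $ a) \<le> C * r\<^sup>2" for a
    using holomorphic_fun_on_second_order[OF remainder_holomorphic sub[OF s] scale_pos[OF s] _ remainder_derivative[OF s]]
    by (metis remainder_zero zero_index)
  then obtain C where C: "\<And>a. C a \<ge> 0"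
    "\<And>a r w. 0 < r \<Longrightarrow> r \<le> s / 2 \<Longrightarrow> w \<in> polydisc r \<Longrightarrow> cmod (remainder s w $ a) \<le> C a * r\<^sup>2"
    by metis
  have "norm ((std_error U z \<psi> r)\<^sup>2 - (std_error U z (first_order_part U z \<psi> s) r)\<^sup>2)
      \<le> (\<Sum>a\<in>UNIV. (C a)\<^sup>2) * norm (r ^ 4)" if r: "0 < r" "r \<le> s / 2" for r
  proof -
    have sc: "r \<in> scales U z" using scales_downward[OF s] r by simp
    let ?ms = "\<lambda>a. mean_square r (\<lambda>w. remainder s w $ a)"
    \<comment> \<open>Squaring \<open>std_error\<close> returns the variance only where it is
      nonnegative; here that is visible from the closed form.\<close>
    have "lens_variance U z (first_order_part U z \<psi> s) r \<ge> 0"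
      unfolding lens_variance_first_order_part[OF s sc]
      by (intro add_nonneg_nonneg divide_nonneg_nonneg mult_nonneg_nonneg trace_sq_nonneg) simp_all
    then have "(std_error U z \<psi> r)\<^sup>2 - (std_error U z (first_order_part U z \<psi> s) r)\<^sup>2 = (\<Sum>a\<in>UNIV. ?ms a)"
      unfolding power2_std_error[OF sc]
      by (simp add: std_error_def lens_variance_split[OF s sc] lens_variance_first_order_part[OF s sc])
    moreover have "?ms a \<le> (C a)\<^sup>2 * r ^ 4" for a
    proof -
      have "?ms a \<le> (C a * r\<^sup>2)\<^sup>2"
        by (intro mean_square_le r holomorphic_fun_on_continuous_torus[OF remainder_holomorphic sub[OF sc]] C(2))
          (use torus_subset_polydisc in blast)
      then show ?thesis by (simp add: power_mult_distrib)
    qed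
    ultimately show ?thesis
      by (simp add: sum_nonneg mean_square_nonneg sum_distrib_right sum_mono)
  qed
  then show ?thesis
    using scale_pos[OF s]
    by (intro bigoI[where c = "\<Sum>a\<in>UNIV. (C a)\<^sup>2"])
      (auto simp: eventually_at_right_field intro!: exI[of _ "s / 2"])
qed

text \<open>The assumption concerns points near 0, whereas the variance sees the torus of radius r;
  the identity theorem carries the vanishing out there.\<close>

lemma remainder_vanishes:
  assumes s: "s \<in> scales U z" and r: "r \<in> scales U z"
    and zero: "\<forall>\<^sub>F w in nhds 0. higher_part U z \<psi> s w = 0" and w: "w \<in> polydisc r"
  shows "remainder s w = 0"
proof -
  have "0 \<in> z ` U" using sub[OF s] zero_in_polydisc[of s] scale_pos[OF s] by auto
  then have "\<forall>\<^sub>F w in nhds 0. w \<in> z ` U" by (rule eventually_nhds_in_open[OF open_image])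
  with zero have "\<forall>\<^sub>F w in nhds 0. remainder s w = 0"
    by eventually_elim (simp add: remainder_def higher_part_def analytic_part_eq[OF s])
  then have "\<forall>\<^sub>F w in nhds 0. remainder s w $ a = 0" for a
    by eventually_elim simp
  from holomorphic_fun_on_identity[OF remainder_holomorphic open_image sub[OF r] this w]
  show ?thesis by (simp add: vec_eq_iff)
qed

end

text \<open>With E = T m^4, the excess over the value at m is the complete square T (m^2 / y -
  y)^2.\<close>

lemma sum_inverse_square_minimum:
  fixes E T y :: real
  assumes "E > 0" "T > 0" "y > 0"
  defines "m \<equiv> (E / T) powr (1 / 4)"
  shows "E / m\<^sup>2 + m\<^sup>2 * T \<le> E / y\<^sup>2 + y\<^sup>2 * T"
proof -
  have m: "m > 0" using assms by (simp add: m_def)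
  have "m ^ 4 = E / T"
    using assms by (simp add: m_def powr_powr flip: powr_numeral)
  then have E: "E = T * m ^ 4" using assms by (simp add: field_simps)
  have "E / y\<^sup>2 + y\<^sup>2 * T - (E / m\<^sup>2 + m\<^sup>2 * T) = T * (m\<^sup>2 / y - y)\<^sup>2"
    using m assms(3) unfolding E by (simp add: field_simps eval_nat_numeral)
  also have "\<dots> \<ge> 0" using assms by simp
  finally show ?thesis by simp
qed

text \<open>In (b) the closed formula minimises the two-term variance. Hence the claim is made for
  the first-order part, whose squared error differs from that of \<psi> by O(r^4), and for \<psi>
  itself when its higher part vanishes near 0. Nonzero \<eta> and D give an interior minimum, and
  membership in \<open>scales\<close> says that the disc of that radius fits into the chart.\<close>

theorem theorem4p4:
  fixes \<A> :: "('m::{t2_space,second_countable_topology} set \<times> ('m \<Rightarrow> complex^'n)) set"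
    and p0 :: 'm
    and U :: "'m set"
    and z :: "'m \<Rightarrow> complex^'n"
    and \<psi> :: "'m \<Rightarrow> complex^'k"
  assumes "holomorphic_atlas \<A>"
    and "centred_morph \<A> p0 U z"
    and "\<psi> \<in> pole_order_le_1 U z"
    and "\<forall>r\<in>scales U z. lens_measurable U z \<psi> r"
  shows
    "(\<forall>r\<in>scales U z.
        r * std_error U z \<psi> r \<ge> sqrt (trace_sq (residue_matrix U z \<psi> r)))
     \<and>
     (\<forall>s\<in>scales U z.
        (\<lambda>r. (std_error U z \<psi> r)\<^sup>2 - (std_error U z (first_order_part U z \<psi> s) r)\<^sup>2)
          \<in> O[at_right 0](\<lambda>r. r ^ 4)
        \<and>
        (let \<eta> = residue_matrix U z \<psi> s;
             D = jacobian_matrix U z \<psi> s;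
             r_min = (trace_sq \<eta> / trace_sq D) powr (1 / 4)
         in \<eta> \<noteq> 0 \<and> D \<noteq> 0 \<and> r_min \<in> scales U z \<longrightarrow>
              is_arg_min (std_error U z (first_order_part U z \<psi> s)) (\<lambda>r. r \<in> scales U z) r_min
              \<and>
              ((\<forall>\<^sub>F w in nhds 0. higher_part U z \<psi> s w = 0) \<longrightarrow>
                 is_arg_min (std_error U z \<psi>) (\<lambda>r. r \<in> scales U z) r_min)))"
proof -
  obtain g \<zeta> where "z = g \<circ> \<zeta>" "biholomorphic_map_on g (\<zeta> ` U)"
    using assms(2) unfolding centred_morph_def morphs_def by blast
  then have "open (z ` U)" by (simp add: biholomorphic_map_on_def image_comp)
  moreover obtain \<eta> h where "holomorphic_map_on h (z ` U)"
    "\<forall>w\<in>z ` U \<inter> off_axes. coord_rep U z \<psi> w = principal \<eta> w + h w"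
    using assms(3) unfolding pole_order_le_1_def by blast
  ultimately interpret polar_chart U z \<psi> \<eta> h by unfold_locales auto
  \<comment> \<open>Stated for any \<phi> with the two-term variance, so that it serves both the
    first-order part and \<psi>.\<close>
  have arg_min: "is_arg_min (std_error U z \<phi>) (\<lambda>r. r \<in> scales U z) m"
    if nz: "residue_matrix U z \<psi> s \<noteq> 0" "jacobian_matrix U z \<psi> s \<noteq> 0"
      and m: "m = (trace_sq (residue_matrix U z \<psi> s) / trace_sq (jacobian_matrix U z \<psi> s)) powr (1 / 4)"
        "m \<in> scales U z" and s: "s \<in> scales U z"
      and variance: "\<And>r. r \<in> scales U z \<Longrightarrow>
        lens_variance U z \<phi> r = trace_sq \<eta> / r\<^sup>2 + r\<^sup>2 * trace_sq (jacobian_matrix U z \<psi> s)"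
    for \<phi> :: "'m \<Rightarrow> complex^'k" and s m
  proof -
    have "lens_variance U z \<phi> m \<le> lens_variance U z \<phi> r" if r: "r \<in> scales U z" for r
      unfolding variance[OF r] variance[OF m(2)] unfolding m(1) residue_matrix_eq[OF s]
      by (rule sum_inverse_square_minimum)
        (use nz trace_sq_pos scale_pos[OF r] residue_matrix_eq[OF s] in auto)
    then show ?thesis using m(2) by (auto simp: is_arg_min_def std_error_def not_less)
  qed
  have exact: "lens_variance U z \<psi> r = trace_sq \<eta> / r\<^sup>2 + r\<^sup>2 * trace_sq (jacobian_matrix U z \<psi> s)"
    if s: "s \<in> scales U z" and "\<forall>\<^sub>F w in nhds 0. higher_part U z \<psi> s w = 0" and r: "r \<in> scales U z" for r s
  proof -
    have "mean_square r (\<lambda>w. remainder s w $ a) = mean_square r (\<lambda>w :: complex^'n. 0)" for a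
    proof (rule mean_square_cong[OF scale_pos[OF r]])
      fix w :: "complex^'n" assume "w \<in> torus r"
      then have "w \<in> polydisc r" using torus_subset_polydisc by blast
      then show "remainder s w $ a = 0" using remainder_vanishes[OF s r that(2)] by simp
    qed
    also have "mean_square r (\<lambda>w :: complex^'n. 0) = 0"
      using mean_square_const[OF scale_pos[OF r], of 0] by simp
    finally show ?thesis unfolding lens_variance_split[OF s r] by simp
  qed
  show ?thesis
    unfolding Let_def
  proof (intro conjI ballI impI; (elim conjE)?)
    fix r assume "r \<in> scales U z"
    then show "sqrt (trace_sq (residue_matrix U z \<psi> r)) \<le> r * std_error U z \<psi> r"
      by (rule std_error_lower_bound)
  next
    fix s assume s: "s \<in> scales U z"
    show "(\<lambda>r. (std_error U z \<psi> r)\<^sup>2 - (std_error U z (first_order_part U z \<psi> s) r)\<^sup>2)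
        \<in> O[at_right 0](\<lambda>r. r ^ 4)"
      by (rule variance_difference_bigo[OF s])
    let ?m = "(trace_sq (residue_matrix U z \<psi> s) / trace_sq (jacobian_matrix U z \<psi> s)) powr (1 / 4)"
    assume nz: "residue_matrix U z \<psi> s \<noteq> 0" "jacobian_matrix U z \<psi> s \<noteq> 0" "?m \<in> scales U z"
    show "is_arg_min (std_error U z (first_order_part U z \<psi> s)) (\<lambda>r. r \<in> scales U z) ?m"
      by (rule arg_min[OF nz(1,2) refl nz(3) s lens_variance_first_order_part[OF s]])
    assume "\<forall>\<^sub>F w in nhds 0. higher_part U z \<psi> s w = 0"
    then show "is_arg_min (std_error U z \<psi>) (\<lambda>r. r \<in> scales U z) ?m"
      by (rule arg_min[OF nz(1,2) refl nz(3) s exact[OF s]])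
  qed
qed

end
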